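(* Let $p\ge5$, $A/\mathbb Z_p$ finite étale cubic, $B=A/pA$, and $\omega\in B$ a generator of $B$. Fix $x\in B^\times$ with $\operatorname{Tr}(x)=s$, $\operatorname{Tr}(\omega x)=0$, $\Delta=\operatorname{Tr}(\omega^2x)\ne0$ (traces of $B/\mathbb F_p$). Fix a lift $U\in A$ of $\omega$, $c\in\mathbb Z_p$ with $\bar c=s$, and let $\mathcal Y$ be the set of classes $y\in A/p^3A$ reducing to $x$ modulo $p$. Call $y\in\mathcal Y$ surviving if $\operatorname{Tr}_A(y)-c\in p^2\mathbb Z_p/p^3\mathbb Z_p$; for surviving $y$ put $A_y\equiv(\operatorname{Tr}_A(y)-c)/p^2$ and $B_y\equiv\operatorname{Tr}_A(yU)/p\pmod p$ (well defined). Then the map $y\mapsto(A_y,B_y)$ from surviving lifts to $\mathbb F_p^2$ has all fibers of equal size. For surviving $y$, with $\tilde y\in A$ any lift and $F_{y,c}(T)=\operatorname{Tr}_A(\tilde y(1+pU)^T)-c\bmod p^3$ (independent of $\tilde y$), the polynomial $Q_y(X)=A_y+B_yX+\Delta\binom X2$ satisfies $F_{y,c}(T)/p^2\equiv Q_y(T)\pmod p$, so its roots are exactly the first branch digits $T\bmod p$ surviving to precision $p^3$. Among surviving lifts, the discriminant of $Q_y$ is a nonsquare with frequency $(p-1)/(2p)$ (no lift to $p^3$), a nonzero square with frequency $(p-1)/(2p)$ (two simple branches), and zero with frequency $1/p$ (one double first digit). Replacing $U$ by another lift of $\omega$ does not change the fiber sizes or these frequencies.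
   Context: $(1+pU)^T$ for $T\in\mathbb Z_p$ is the convergent binomial series. Frequencies are proportions among all surviving $y\in\mathcal Y$. *)

theory Defs
  imports
    "Berlekamp_Zassenhaus.Finite_Field"
    "HOL-Computational_Algebra.Nth_Powers"
    Complex_Main
begin

section \<open>The ring of p-adic integers\<close>

text \<open>
  The prime is \<open>p = CARD('p)\<close>, as for \<open>'p mod_ring\<close>, which serves as the field with \<open>p\<close> elements.
  The p-adic integers are the inverse limit of the rings \<open>\<int>/p\<^sup>n\<int>\<close>; the \<open>n\<close>-th entry of a compatible
  sequence is the representative in \<open>{0..<p\<^sup>n}\<close>.
\<close>

typedef 'p padic_int = "{f :: nat \<Rightarrow> int. \<forall>n. f n = f (Suc n) mod int CARD('p) ^ n}"
  morphisms padic_res Abs_padic_int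
  by (rule exI[of _ "\<lambda>_. 0"]) simp

setup_lifting type_definition_padic_int

lemma mod_mod_Suc_power: "x mod p ^ Suc n mod p ^ n = x mod (p ^ n :: int)"
  by (rule mod_mod_cancel) simp

instantiation padic_int :: (prime_card) comm_ring_1
begin

lift_definition zero_padic_int :: "'p::prime_card padic_int" is "\<lambda>_. 0"
  by simp

lift_definition one_padic_int :: "'p::prime_card padic_int" is "\<lambda>n. 1 mod int CARD('p) ^ n"
  by (simp (no_asm) only: mod_mod_Suc_power simp_thms)

lift_definition plus_padic_int :: "'p::prime_card padic_int \<Rightarrow> 'p padic_int \<Rightarrow> 'p padic_int"
  is "\<lambda>f g n. (f n + g n) mod int CARD('p) ^ n"
  by (simp (no_asm) only: mod_mod_Suc_power) (metis mod_add_eq)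

lift_definition uminus_padic_int :: "'p::prime_card padic_int \<Rightarrow> 'p padic_int"
  is "\<lambda>f n. (- f n) mod int CARD('p) ^ n"
  by (simp (no_asm) only: mod_mod_Suc_power) (metis mod_minus_eq)

lift_definition minus_padic_int :: "'p::prime_card padic_int \<Rightarrow> 'p padic_int \<Rightarrow> 'p padic_int"
  is "\<lambda>f g n. (f n - g n) mod int CARD('p) ^ n"
  by (simp (no_asm) only: mod_mod_Suc_power) (metis mod_diff_eq)

lift_definition times_padic_int :: "'p::prime_card padic_int \<Rightarrow> 'p padic_int \<Rightarrow> 'p padic_int"
  is "\<lambda>f g n. (f n * g n) mod int CARD('p) ^ n"
  by (simp (no_asm) only: mod_mod_Suc_power) (metis mod_mult_eq)

lemma padic_res_mod: "padic_res a n mod int CARD('p) ^ n = padic_res (a :: 'p padic_int) n"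
proof -
  have "padic_res a n = padic_res a (Suc n) mod int CARD('p) ^ n"
    using padic_res[of a] by blast
  then show ?thesis
    by (metis mod_mod_trivial)
qed

lemma padic_int_eqI: "(\<And>n. padic_res a n = padic_res b n) \<Longrightarrow> a = (b :: 'p padic_int)"
  by (simp add: padic_res_inject[symmetric] fun_eq_iff)

lemmas padic_res_simps =
  zero_padic_int.rep_eq one_padic_int.rep_eq plus_padic_int.rep_eq uminus_padic_int.rep_eq
  minus_padic_int.rep_eq times_padic_int.rep_eq

instance
proof
  fix a b c :: "'a padic_int"
  show "a * b * c = a * (b * c)"
    by (rule padic_int_eqI) (simp add: padic_res_simps mod_simps mult.assoc)
  show "a * b = b * a"
    by (rule padic_int_eqI) (simp add: padic_res_simps mult.commute)
  show "1 * a = a"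
    by (rule padic_int_eqI) (simp add: padic_res_simps mod_simps padic_res_mod)
  show "a + b + c = a + (b + c)"
    by (rule padic_int_eqI) (simp add: padic_res_simps mod_simps add.assoc)
  show "a + b = b + a"
    by (rule padic_int_eqI) (simp add: padic_res_simps add.commute)
  show "0 + a = a"
    by (rule padic_int_eqI) (simp add: padic_res_simps padic_res_mod)
  show "- a + a = 0"
    by (rule padic_int_eqI) (simp add: padic_res_simps mod_simps)
  show "a - b = a + - b"
    by (rule padic_int_eqI) (simp add: padic_res_simps mod_simps)
  show "(a + b) * c = a * c + b * c"
    by (rule padic_int_eqI) (simp add: padic_res_simps mod_simps distrib_right)
  have "padic_res (1 :: 'a padic_int) 1 = 1"
    using prime_gt_1_nat[OF prime_card[where ?'a='a]] by (simp add: padic_res_simps)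
  then show "(0 :: 'a padic_int) \<noteq> 1"
    by (metis zero_neq_one zero_padic_int.rep_eq)
qed

end

definition padic_mod_p :: "'p::prime_card padic_int \<Rightarrow> 'p mod_ring"
  where "padic_mod_p z = of_int_mod_ring (padic_res z 1)"

text \<open>The residue class of \<open>z / p\<^sup>k\<close> modulo \<open>p\<close>; meaningful only if \<open>p\<^sup>k\<close> divides \<open>z\<close>.\<close>

definition padic_quot_mod_p :: "nat \<Rightarrow> 'p::prime_card padic_int \<Rightarrow> 'p mod_ring"
  where "padic_quot_mod_p k z = padic_mod_p (THE q. z = of_nat CARD('p) ^ k * q)"

definition padic_binomial :: "'p::prime_card padic_int \<Rightarrow> nat \<Rightarrow> 'p padic_int"
  where "padic_binomial T n = (THE b. of_nat (fact n) * b = (\<Prod>i<n. T - of_nat i))"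


section \<open>Algebras, traces, finite etale algebras\<close>

locale comm_algebra = Modules.module scale
  for scale :: "'r::comm_ring_1 \<Rightarrow> 'a::comm_ring \<Rightarrow> 'a" +
  assumes scale_mult_left: "scale r (a * b) = scale r a * b"

definition is_finite_basis :: "('r::comm_ring_1 \<Rightarrow> 'a::ab_group_add \<Rightarrow> 'a) \<Rightarrow> 'a set \<Rightarrow> bool"
  where "is_finite_basis scale E \<longleftrightarrow>
    finite E \<and> \<not> Modules.module.dependent scale E \<and> Modules.module.span scale E = UNIV"

text \<open>
  The trace of multiplication by \<open>a\<close>, computed in some basis (over a commutative ring the result
  does not depend on the basis).
\<close>

definition alg_trace :: "('r::comm_ring_1 \<Rightarrow> 'a::comm_ring \<Rightarrow> 'a) \<Rightarrow> 'a \<Rightarrow> 'r"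
  where "alg_trace scale a =
    (let E = (SOME E. is_finite_basis scale E)
     in \<Sum>e\<in>E. Modules.module.representation scale E (a * e) e)"

text \<open>
  Finite etale algebras of constant rank \<open>n\<close> over a base whose finite projective modules are free
  (such as a local ring): free of rank \<open>n\<close> and separable, that is, \<open>a \<mapsto> Tr(a \<sqdot>)\<close> is an
  isomorphism from the algebra onto its module dual (Lenstra, Galois theory for schemes).
\<close>

definition finite_etale_of_rank :: "nat \<Rightarrow> ('r::comm_ring_1 \<Rightarrow> 'a::comm_ring_1 \<Rightarrow> 'a) \<Rightarrow> bool"
  where "finite_etale_of_rank n scale \<longleftrightarrow>
    comm_algebra scale \<and>
    (\<exists>E. is_finite_basis scale E \<and> card E = n) \<and>
    bij_betw (\<lambda>a b. alg_trace scale (a * b)) UNIV {f. Modules.module_hom scale (*) f}"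

definition generates_algebra ::
    "('r::comm_ring_1 \<Rightarrow> 'a::{comm_ring,comm_monoid_mult} \<Rightarrow> 'a) \<Rightarrow> 'a \<Rightarrow> bool"
  where "generates_algebra scale w \<longleftrightarrow> Modules.module.span scale (range (\<lambda>i::nat. w ^ i)) = UNIV"


section \<open>Reduction modulo p\<close>

text \<open>
  \<open>('a, 'p) red_alg\<close> is the ring \<open>A/pA\<close> for \<open>A = 'a\<close> and \<open>p = CARD('p)\<close>. It may be the zero ring,
  hence is not an instance of \<open>comm_ring_1\<close>.
\<close>

quotient_type (overloaded) ('a, 'p) red_alg =
  "'a::comm_ring_1" / "\<lambda>a b :: 'a::comm_ring_1. of_nat CARD('p) dvd a - b"
  morphisms rep_red_alg red_mod_p
proof (rule equivpI)
  show "reflp (\<lambda>a b :: 'a. of_nat CARD('p) dvd a - b)"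
    by (simp add: reflp_def)
  show "symp (\<lambda>a b :: 'a. of_nat CARD('p) dvd a - b)"
    by (metis (mono_tags, lifting) dvd_minus_iff minus_diff_eq sympI)
  show "transp (\<lambda>a b :: 'a. of_nat CARD('p) dvd a - b)"
    by (rule transpI) (metis (no_types, lifting) diff_add_cancel diff_diff_eq2 dvd_add)
qed

instantiation red_alg :: (comm_ring_1, type) "{comm_ring, comm_monoid_mult}"
begin

lift_definition zero_red_alg :: "('a, 'p) red_alg" is 0 .

lift_definition one_red_alg :: "('a, 'p) red_alg" is 1 .

lift_definition plus_red_alg :: "('a, 'p) red_alg \<Rightarrow> ('a, 'p) red_alg \<Rightarrow> ('a, 'p) red_alg" is "(+)"
  by (metis (no_types, lifting) add_diff_add dvd_add)

lift_definition uminus_red_alg :: "('a, 'p) red_alg \<Rightarrow> ('a, 'p) red_alg" is uminus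
  by (metis dvd_minus_iff minus_diff_minus)

lift_definition minus_red_alg :: "('a, 'p) red_alg \<Rightarrow> ('a, 'p) red_alg \<Rightarrow> ('a, 'p) red_alg" is "(-)"
proof -
  fix a a' b b' :: 'a
  assume "of_nat CARD('p) dvd a - a'" "of_nat CARD('p) dvd b - b'"
  then have "of_nat CARD('p) dvd (a - a') - (b - b')"
    by (rule dvd_diff)
  then show "of_nat CARD('p) dvd (a - b) - (a' - b')"
    by (simp add: algebra_simps)
qed

lift_definition times_red_alg :: "('a, 'p) red_alg \<Rightarrow> ('a, 'p) red_alg \<Rightarrow> ('a, 'p) red_alg" is "(*)"
proof -
  fix a a' b b' :: 'a
  assume "of_nat CARD('p) dvd a - a'" "of_nat CARD('p) dvd b - b'"
  then have "of_nat CARD('p) dvd (a - a') * b + a' * (b - b')"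
    by (intro dvd_add dvd_mult dvd_mult2)
  then show "of_nat CARD('p) dvd a * b - a' * b'"
    by (simp add: algebra_simps)
qed

instance
  by standard (transfer; simp add: algebra_simps)+

end

text \<open>
  The algebra structure of \<open>A/pA\<close> over the field with \<open>p\<close> elements; it is the one induced by any
  structure of algebra over the p-adic integers on \<open>A\<close>.
\<close>

definition red_scale :: "'p::prime_card mod_ring \<Rightarrow> ('a::comm_ring_1, 'p) red_alg \<Rightarrow> ('a, 'p) red_alg"
  where "red_scale r b = red_mod_p (of_int (to_int_mod_ring r)) * b"


lemma comm_algebra_red_scale:
  "comm_algebra (red_scale :: 'p::prime_card mod_ring \<Rightarrow> ('a::comm_ring_1, 'p) red_alg \<Rightarrow> _)"
proof -
  have *: "red_mod_p (of_int k) = (red_mod_p (of_int l) :: ('a, 'p) red_alg)"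
    if "int CARD('p) dvd k - l" for k l
  proof -
    from that obtain m where "k - l = int CARD('p) * m" ..
    then have "(of_int k - of_int l :: 'a) = of_int (int CARD('p) * m)"
      by (metis of_int_diff)
    then have "(of_int k - of_int l :: 'a) = of_nat CARD('p) * of_int m"
      by simp
    then have "of_nat CARD('p) dvd (of_int k - of_int l :: 'a)"
      by (rule dvdI)
    then show ?thesis
      by (simp add: red_alg.abs_eq_iff)
  qed
  have add: "red_mod_p (of_int (to_int_mod_ring (r + r'))) =
      red_mod_p (of_int (to_int_mod_ring r)) +
      (red_mod_p (of_int (to_int_mod_ring r')) :: ('a, 'p) red_alg)" for r r' :: "'p mod_ring"
  proof -
    have "int CARD('p) dvd to_int_mod_ring (r + r') - (to_int_mod_ring r + to_int_mod_ring r')"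
      by transfer (simp add: mod_eq_dvd_iff[symmetric])
    from *[OF this] show ?thesis
      by (simp add: plus_red_alg.abs_eq)
  qed
  have mult: "red_mod_p (of_int (to_int_mod_ring (r * r'))) =
      red_mod_p (of_int (to_int_mod_ring r)) *
      (red_mod_p (of_int (to_int_mod_ring r')) :: ('a, 'p) red_alg)" for r r' :: "'p mod_ring"
  proof -
    have "int CARD('p) dvd to_int_mod_ring (r * r') - to_int_mod_ring r * to_int_mod_ring r'"
      by transfer (simp add: mod_eq_dvd_iff[symmetric])
    from *[OF this] show ?thesis
      by (simp add: times_red_alg.abs_eq)
  qed
  have one: "red_mod_p (of_int (to_int_mod_ring (1 :: 'p mod_ring))) = (1 :: ('a, 'p) red_alg)"
    by (simp add: one_red_alg.abs_eq)
  show ?thesis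
    by unfold_locales (simp_all only: red_scale_def add mult one distrib_left distrib_right mult.assoc mult_1_left)
qed


section \<open>Lifts modulo the cube of p, and branches\<close>

text \<open>A residue class in \<open>A/p\<^sup>3A\<close> is the set of its lifts to \<open>A\<close>.\<close>

definition lifts_mod_p3 :: "('a::comm_ring_1, 'p::prime_card) red_alg \<Rightarrow> 'a set set"
  where "lifts_mod_p3 x =
    {y \<in> UNIV // {(a, b). of_nat CARD('p) ^ 3 dvd a - b}. red_mod_p ` y = {x}}"

definition surviving ::
    "('p::prime_card padic_int \<Rightarrow> 'a::comm_ring_1 \<Rightarrow> 'a) \<Rightarrow> ('a, 'p) red_alg \<Rightarrow> 'p padic_int \<Rightarrow>
      'a set set"
  where "surviving scale x c =
    {y \<in> lifts_mod_p3 x. \<forall>a\<in>y. of_nat CARD('p) ^ 2 dvd alg_trace scale a - c}"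

text \<open>\<open>A\<^sub>y\<close> and \<open>B\<^sub>y\<close>: the common value over all lifts of \<open>y\<close>.\<close>

definition A_digit ::
    "('p::prime_card padic_int \<Rightarrow> 'a::comm_ring_1 \<Rightarrow> 'a) \<Rightarrow> 'p padic_int \<Rightarrow> 'a set \<Rightarrow> 'p mod_ring"
  where "A_digit scale c y = the_elem ((\<lambda>a. padic_quot_mod_p 2 (alg_trace scale a - c)) ` y)"

definition B_digit ::
    "('p::prime_card padic_int \<Rightarrow> 'a::comm_ring_1 \<Rightarrow> 'a) \<Rightarrow> 'a \<Rightarrow> 'a set \<Rightarrow> 'p mod_ring"
  where "B_digit scale U y = the_elem ((\<lambda>a. padic_quot_mod_p 1 (alg_trace scale (a * U))) ` y)"

definition p_adic_limit :: "nat \<Rightarrow> (nat \<Rightarrow> 'a::comm_ring_1) \<Rightarrow> 'a"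
  where "p_adic_limit p S = (THE L. \<forall>k. \<exists>N. \<forall>n\<ge>N. of_nat p ^ k dvd S n - L)"

text \<open>The binomial series for \<open>(1 + pU)\<^sup>T\<close>.\<close>

definition one_plus_p_pow ::
    "('p::prime_card padic_int \<Rightarrow> 'a::comm_ring_1 \<Rightarrow> 'a) \<Rightarrow> 'a \<Rightarrow> 'p padic_int \<Rightarrow> 'a"
  where "one_plus_p_pow scale U T =
    p_adic_limit CARD('p) (\<lambda>N. \<Sum>n<N. scale (padic_binomial T n) ((of_nat CARD('p) * U) ^ n))"

text \<open>\<open>F\<^bsub>y,c\<^esub>(T)\<close>, before reduction modulo \<open>p\<^sup>3\<close>, for the lift \<open>a\<close> of \<open>y\<close>.\<close>

definition branch_fun ::
    "('p::prime_card padic_int \<Rightarrow> 'a::comm_ring_1 \<Rightarrow> 'a) \<Rightarrow> 'a \<Rightarrow> 'p padic_int \<Rightarrow> 'a \<Rightarrow>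
      'p padic_int \<Rightarrow> 'p padic_int"
  where "branch_fun scale U c a T = alg_trace scale (a * one_plus_p_pow scale U T) - c"

definition branch_digits ::
    "('p::prime_card padic_int \<Rightarrow> 'a::comm_ring_1 \<Rightarrow> 'a) \<Rightarrow> 'a \<Rightarrow> 'p padic_int \<Rightarrow> 'a set \<Rightarrow>
      'p mod_ring set"
  where "branch_digits scale U c y =
    padic_mod_p ` {T. \<forall>a\<in>y. of_nat CARD('p) ^ 3 dvd branch_fun scale U c a T}"

text \<open>\<open>Q\<^sub>y(X) = A\<^sub>y + B\<^sub>y X + \<Delta> X(X - 1)/2\<close>\<close>

definition branch_poly ::
    "('p::prime_card padic_int \<Rightarrow> 'a::comm_ring_1 \<Rightarrow> 'a) \<Rightarrow> 'a \<Rightarrow> 'p padic_int \<Rightarrow> 'p mod_ring \<Rightarrow>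
      'a set \<Rightarrow> 'p mod_ring poly"
  where "branch_poly scale U c \<Delta> y =
    [:A_digit scale c y, B_digit scale U y:] + smult (\<Delta> / 2) ([:0, 1:] * [:-1, 1:])"

definition quadratic_disc :: "'a::comm_ring_1 poly \<Rightarrow> 'a"
  where "quadratic_disc q = (Polynomial.coeff q 1)\<^sup>2 - 4 * Polynomial.coeff q 2 * Polynomial.coeff q 0"

definition frequency :: "'b set \<Rightarrow> ('b \<Rightarrow> bool) \<Rightarrow> real"
  where "frequency S P = real (card {y \<in> S. P y}) / real (card S)"

end

theory Submission
  imports Defs "HOL-Library.FuncSet"
begin

text \<open>
  Modulo \<open>p\<^sup>3\<close> the series \<open>(1 + pU)\<^sup>T\<close> is \<open>1 + T p U + binom(T,2) p\<^sup>2 U\<^sup>2\<close>, since all further terms are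
  divisible by \<open>p\<^sup>3\<close>; taking traces against a surviving lift and dividing by \<open>p\<^sup>2\<close> gives \<open>Q\<^sub>y(T)\<close>.
  The elements \<open>1\<close> and \<open>\<omega>\<close> are linearly independent: if \<open>\<omega>\<close> were a scalar \<open>k\<close>, then
  \<open>\<Delta> = k Tr(\<omega> x) = 0\<close>. By nondegeneracy of the trace form there are therefore elements with
  prescribed values of \<open>Tr z\<close> and \<open>Tr(z U)\<close>, and translation by \<open>p\<close> times such elements permutes the
  fibres of \<open>y \<mapsto> (A\<^sub>y, B\<^sub>y)\<close> transitively. Finally, the discriminant of \<open>Q\<^sub>y\<close> is affine in \<open>A\<^sub>y\<close> with
  slope \<open>-2\<Delta> \<noteq> 0\<close>, so it is equidistributed, and the frequencies are those of squares in the field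
  with \<open>p\<close> elements.
\<close>

section \<open>p-adic integers\<close>

lemma padic_res_of_nat: "padic_res (of_nat m :: 'p::prime_card padic_int) n = int m mod int CARD('p) ^ n"
  by (induction m) (simp_all add: padic_res_simps mod_simps add.commute)

lemma padic_res_of_int: "padic_res (of_int k :: 'p::prime_card padic_int) n = k mod int CARD('p) ^ n"
  by (cases k rule: int_cases2) (simp_all add: padic_res_of_nat padic_res_simps mod_simps)

lemma padic_res_mod_le:
  assumes "k \<le> n"
  shows "padic_res (z :: 'p::prime_card padic_int) n mod int CARD('p) ^ k = padic_res z k"
  using assms
proof (induction n rule: dec_induct)
  case base
  show ?case by (rule padic_res_mod)
next
  case (step n)
  have "padic_res z n = padic_res z (Suc n) mod int CARD('p) ^ n"
    using padic_res[of z] by blast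
  then have "padic_res z n mod int CARD('p) ^ k = padic_res z (Suc n) mod int CARD('p) ^ k"
    using step by (simp add: mod_mod_cancel le_imp_power_dvd)
  with step show ?case by simp
qed

lemma padic_res_prime_power_mult:
  "padic_res (of_nat CARD('p) ^ k * z :: 'p::prime_card padic_int) n =
    int CARD('p) ^ k * padic_res z n mod int CARD('p) ^ n"
proof -
  have "(of_nat CARD('p) ^ k :: 'p padic_int) = of_nat (CARD('p) ^ k)"
    by simp
  then show ?thesis
    by (simp only: times_padic_int.rep_eq padic_res_of_nat) (simp add: mod_simps)
qed

lemma padic_prime_power_dvd_iff:
  "of_nat CARD('p) ^ k dvd (z :: 'p::prime_card padic_int) \<longleftrightarrow> padic_res z k = 0"
proof
  assume "of_nat CARD('p) ^ k dvd z"
  then obtain q where "z = of_nat CARD('p) ^ k * q" ..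
  then show "padic_res z k = 0"
    by (simp only: padic_res_prime_power_mult) simp
next
  let ?p = "int CARD('p)"
  assume z: "padic_res z k = 0"
  \<comment> \<open>Dividing by \<open>p^k\<close> costs \<open>k\<close> digits of precision, so
    entry \<open>n\<close> of the quotient is read off from entry \<open>n + k\<close> of
    \<open>z\<close>.\<close>
  define f where "f n = padic_res z (n + k) div ?p ^ k" for n
  have pos: "?p > 0"
    by simp
  have split: "padic_res z (n + k) = ?p ^ k * f n" for n
    using padic_res_mod_le[of k "n + k" z] z by (simp add: f_def mod_eq_0_iff_dvd)
  have "f n = f (Suc n) mod ?p ^ n" for n
  proof -
    have "?p ^ k * f n = (?p ^ k * f (Suc n)) mod ?p ^ (n + k)"
      using padic_res_mod_le[of "n + k" "Suc n + k" z] split[of n] split[of "Suc n"] by simp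
    also have "\<dots> = ?p ^ k * (f (Suc n) mod ?p ^ n)"
      by (simp only: power_add mult.commute[of "?p ^ n"] mult_mod_right)
    finally show ?thesis
      using pos by simp
  qed
  then have f: "padic_res (Abs_padic_int f :: 'p padic_int) = f"
    by (intro Abs_padic_int_inverse) blast
  have "z = of_nat CARD('p) ^ k * Abs_padic_int f"
  proof (rule padic_int_eqI)
    fix n
    show "padic_res z n = padic_res (of_nat CARD('p) ^ k * Abs_padic_int f :: 'p padic_int) n"
      unfolding padic_res_prime_power_mult f split[symmetric]
      by (simp add: padic_res_mod_le)
  qed
  then show "of_nat CARD('p) ^ k dvd z" ..
qed

lemma padic_int_eq_0I:
  assumes "\<And>k. of_nat CARD('p) ^ k dvd (z :: 'p::prime_card padic_int)"
  shows "z = 0"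
  using assms by (intro padic_int_eqI) (simp add: padic_prime_power_dvd_iff zero_padic_int.rep_eq)

text \<open>If \<open>p^k (a - b) = 0\<close>, then entry \<open>n + k\<close> of
  \<open>a - b\<close> is divisible by \<open>p^n\<close>, so \<open>a - b\<close> is divisible by
  every power of the prime. This torsion-freeness makes the quotient in
  \<open>padic_quot_mod_p\<close> unique.\<close>

lemma padic_prime_power_mult_cancel:
  "of_nat CARD('p) ^ k * a = of_nat CARD('p) ^ k * b \<longleftrightarrow> a = (b :: 'p::prime_card padic_int)"
proof
  assume "of_nat CARD('p) ^ k * a = of_nat CARD('p) ^ k * b"
  then have 0: "of_nat CARD('p) ^ k * (a - b) = 0"
    by (simp add: right_diff_distrib)
  have "a - b = 0"
  proof (rule padic_int_eq_0I)
    fix n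
    have "int CARD('p) ^ k * padic_res (a - b) (n + k) mod int CARD('p) ^ (n + k) = 0"
      using arg_cong[OF 0, of "\<lambda>z. padic_res z (n + k)"]
      by (simp only: padic_res_prime_power_mult zero_padic_int.rep_eq)
    then have "int CARD('p) ^ n dvd padic_res (a - b) (n + k)"
      by (simp add: power_add mult.commute mod_eq_0_iff_dvd)
    then have "padic_res (a - b) (n + k) mod int CARD('p) ^ n = 0"
      by simp
    then show "of_nat CARD('p) ^ n dvd a - b"
      by (simp add: padic_prime_power_dvd_iff padic_res_mod_le)
  qed
  then show "a = b" by simp
qed simp

lemma padic_int_cases_mod:
  obtains i q where "i \<in> {0..<int CARD('p) ^ k}"
    "(z :: 'p::prime_card padic_int) = of_int i + of_nat CARD('p) ^ k * q"
proof -
  have "of_nat CARD('p) ^ k dvd z - of_int (padic_res z k)"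
    by (simp add: padic_prime_power_dvd_iff padic_res_simps padic_res_of_int mod_simps)
  then obtain q where "z - of_int (padic_res z k) = of_nat CARD('p) ^ k * q" ..
  then have "z = of_int (padic_res z k) + of_nat CARD('p) ^ k * q"
    by (simp add: algebra_simps)
  moreover have "padic_res z k \<in> {0..<int CARD('p) ^ k}"
    using padic_res_mod[of z k] by (metis atLeastLessThan_iff pos_mod_bound pos_mod_sign
        of_nat_0_less_iff zero_less_card_finite zero_less_power)
  ultimately show ?thesis using that by blast
qed

text \<open>The diagonal, entry \<open>n\<close> of \<open>S n\<close>, is a compatible sequence and
  hence the limit. The explicit rate is kept because it later tells where the binomial series may be
  cut off.\<close>

lemma padic_int_complete:
  fixes S :: "nat \<Rightarrow> 'p::prime_card padic_int"
  assumes "\<And>n. of_nat CARD('p) ^ n dvd S (Suc n) - S n"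
  shows "\<exists>L. \<forall>n. of_nat CARD('p) ^ n dvd S n - L"
proof -
  let ?p = "int CARD('p)"
  have S: "padic_res (S (Suc n)) n = padic_res (S n) n" for n
  proof -
    have "(padic_res (S (Suc n)) n - padic_res (S n) n) mod ?p ^ n = 0"
      using assms[of n] by (simp add: padic_prime_power_dvd_iff padic_res_simps)
    then have "padic_res (S (Suc n)) n mod ?p ^ n = padic_res (S n) n mod ?p ^ n"
      by (simp add: mod_eq_dvd_iff mod_eq_0_iff_dvd)
    then show ?thesis
      by (simp add: padic_res_mod)
  qed
  define f where "f n = padic_res (S n) n" for n
  have "f n = f (Suc n) mod ?p ^ n" for n
    by (simp add: f_def padic_res_mod_le S)
  then have f: "padic_res (Abs_padic_int f :: 'p padic_int) = f"
    by (intro Abs_padic_int_inverse) blast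
  have "of_nat CARD('p) ^ n dvd S n - Abs_padic_int f" for n
    by (simp add: padic_prime_power_dvd_iff padic_res_simps f) (simp add: f_def)
  then show ?thesis by blast
qed

section \<open>Reduction modulo p, quotient digits and the inverse of 2\<close>

lemma of_int_mod_card: "(of_int (k mod int CARD('p)) :: 'p::prime_card mod_ring) = of_int k"
  using of_int_mod_CHAR[where ?'a="'p mod_ring", of k] by simp

lemma padic_mod_p_simps [simp]:
  fixes a b :: "'p::prime_card padic_int"
  shows "padic_mod_p (a + b) = padic_mod_p a + padic_mod_p b"
    and "padic_mod_p (a - b) = padic_mod_p a - padic_mod_p b"
    and "padic_mod_p (a * b) = padic_mod_p a * padic_mod_p b"
    and "padic_mod_p (of_int k :: 'p padic_int) = of_int k"
    and "padic_mod_p (0 :: 'p padic_int) = 0"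
    and "padic_mod_p (1 :: 'p padic_int) = 1"
  by (simp_all add: padic_mod_p_def of_int_of_int_mod_ring[symmetric] padic_res_simps
      padic_res_of_int of_int_mod_card)

lemma padic_mod_p_of_nat [simp]: "padic_mod_p (of_nat k :: 'p::prime_card padic_int) = of_nat k"
  using padic_mod_p_simps(4)[where ?'p='p, of "int k"] by simp

lemma padic_mod_p_sum [simp]:
  "padic_mod_p (sum f I :: 'p::prime_card padic_int) = (\<Sum>i\<in>I. padic_mod_p (f i))"
  by (induction I rule: infinite_finite_induct) simp_all

lemma padic_mod_p_eq_0_iff:
  "padic_mod_p z = 0 \<longleftrightarrow> of_nat CARD('p) dvd (z :: 'p::prime_card padic_int)"
proof -
  have z: "padic_res z 1 mod int CARD('p) = padic_res z 1"
    using padic_res_mod[of z 1] by simp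
  have "padic_mod_p z = 0 \<longleftrightarrow> int CARD('p) dvd padic_res z 1"
    by (simp add: padic_mod_p_def of_int_of_int_mod_ring[symmetric] of_int_eq_0_iff_char_dvd)
  also have "\<dots> \<longleftrightarrow> padic_res z 1 = 0"
    using z by (metis mod_eq_0_iff_dvd)
  also have "\<dots> \<longleftrightarrow> of_nat CARD('p) dvd z"
    using padic_prime_power_dvd_iff[of 1 z] by simp
  finally show ?thesis .
qed

lemma padic_mod_p_surj: obtains z where "padic_mod_p z = (t :: 'p::prime_card mod_ring)"
  using that[of "of_int (to_int_mod_ring t)"] by (simp add: of_int_of_int_mod_ring)

lemma padic_quot_mod_p_mult [simp]:
  "padic_quot_mod_p k (of_nat CARD('p) ^ k * q) = padic_mod_p (q :: 'p::prime_card padic_int)"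
  by (simp add: padic_quot_mod_p_def padic_prime_power_mult_cancel)

text \<open>The inverse of 2 is the limit of \<open>(p^n + 1) / 2\<close>, which inverts 2 modulo
  \<open>p^n\<close>.\<close>

lemma padic_half:
  assumes "odd CARD('p)"
  obtains h :: "'p::prime_card padic_int" where "2 * h = 1"
proof -
  have dvd: "of_nat CARD('p) ^ n dvd (of_nat ((CARD('p) ^ Suc n + 1) div 2) -
      of_nat ((CARD('p) ^ n + 1) div 2) :: 'p padic_int)" for n
  proof -
    obtain m where m: "CARD('p) = 2 * m + 1"
      using assms by (rule oddE)
    have "odd (CARD('p) ^ n)"
      using assms by simp
    then obtain k where k: "CARD('p) ^ n = 2 * k + 1"
      by (rule oddE)
    have "CARD('p) ^ Suc n + 1 = 2 * (CARD('p) ^ n * m + (k + 1))"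
      using k by (simp add: m algebra_simps)
    then have "(CARD('p) ^ Suc n + 1) div 2 = CARD('p) ^ n * m + (k + 1)"
      by simp
    moreover have "(CARD('p) ^ n + 1) div 2 = k + 1"
      by (simp add: k)
    ultimately show ?thesis
      by simp
  qed
  then obtain h :: "'p padic_int" where
    h: "\<And>n. of_nat CARD('p) ^ n dvd of_nat ((CARD('p) ^ n + 1) div 2) - h"
    using padic_int_complete[of "\<lambda>n. of_nat ((CARD('p) ^ n + 1) div 2)"] by blast
  have "2 * h - 1 = 0"
  proof (rule padic_int_eq_0I)
    fix n
    have "even (CARD('p) ^ n + 1)"
      using assms by simp
    then have "2 * ((CARD('p) ^ n + 1) div 2) = CARD('p) ^ n + 1"
      by (rule dvd_mult_div_cancel)
    from arg_cong[OF this, of "of_nat :: nat \<Rightarrow> 'p padic_int"]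
    have "2 * of_nat ((CARD('p) ^ n + 1) div 2) = (of_nat CARD('p) ^ n + 1 :: 'p padic_int)"
      by simp
    then have "2 * h - 1 = of_nat CARD('p) ^ n - 2 * (of_nat ((CARD('p) ^ n + 1) div 2) - h)"
      by (simp add: algebra_simps)
    with h[of n] show "of_nat CARD('p) ^ n dvd 2 * h - 1"
      by (metis dvd_diff dvd_mult dvd_refl)
  qed
  then show ?thesis
    using that by simp
qed

section \<open>Traces and reduction modulo p\<close>

lemma red_mod_p_eq_iff:
  "(red_mod_p a :: ('a::comm_ring_1, 'p) red_alg) = red_mod_p b \<longleftrightarrow> of_nat CARD('p) dvd a - b"
  by (simp add: red_alg.abs_eq_iff)

lemma red_mod_p_surj: obtains a where "red_mod_p a = (b :: ('a::comm_ring_1, 'p) red_alg)"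
  using that by (induction b rule: red_alg.abs_induct) simp

lemma red_mod_p_rep [simp]: "red_mod_p (rep_red_alg b) = b"
  by (rule Quotient_abs_rep[OF Quotient_red_alg])

lemma red_mod_p_sum: "(\<Sum>i\<in>I. red_mod_p (f i)) = red_mod_p (sum f I)"
  by (induction I rule: infinite_finite_induct)
    (simp_all add: plus_red_alg.abs_eq zero_red_alg_def[symmetric])

lemma red_mod_p_power: "red_mod_p a ^ n = red_mod_p (a ^ n)"
  by (induction n) (simp_all add: times_red_alg.abs_eq one_red_alg_def[symmetric])

lemma is_finite_basisD:
  assumes "Modules.module scale" "is_finite_basis scale E"
  shows "finite E"
    and "(\<Sum>e\<in>E. scale (Modules.module.representation scale E v e) e) = v"
    and "Modules.module_hom scale (*) (\<lambda>v. Modules.module.representation scale E v e)"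
proof -
  interpret Modules.module scale by fact
  have E: "finite E" "independent E" "span E = UNIV"
    using assms(2) by (auto simp: is_finite_basis_def)
  show "finite E" by fact
  show "(\<Sum>e\<in>E. scale (representation E v e) e) = v"
    by (rule sum_representation_eq) (use E in auto)
  show "Modules.module_hom scale (*) (\<lambda>v. representation E v e)"
    by unfold_locales (use E in \<open>simp_all add: representation_add representation_scale algebra_simps\<close>)
qed

context comm_algebra
begin

lemma mult_scale_right: "a * scale r b = scale r (a * b)"
  by (metis mult.commute scale_mult_left)

text \<open>Dual basis lemma: a basis is not needed to compute the trace, a generating family \<open>b\<close> with
  linear coefficient functions \<open>f\<close> suffices.\<close>

lemma alg_trace_dual_basis:
  assumes ex: "is_finite_basis scale E" and "finite I"
    and f: "\<And>i. i \<in> I \<Longrightarrow> Modules.module_hom scale (*) (f i)"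
    and gen: "\<And>v. v = (\<Sum>i\<in>I. scale (f i v) (b i))"
  shows "alg_trace scale a = (\<Sum>i\<in>I. f i (a * b i))"
proof -
  define E where "E = (SOME E. is_finite_basis scale E)"
  have "is_finite_basis scale E"
    unfolding E_def by (rule someI) fact
  note E = is_finite_basisD[OF module_axioms this]
  let ?R = "representation E"
  have R_sum: "?R (\<Sum>i\<in>I. scale (r i) (v i)) e = (\<Sum>i\<in>I. r i * ?R (v i) e)" for r v e
  proof -
    interpret R: module_hom scale "(*)" "\<lambda>v. ?R v e" by (rule E)
    show ?thesis by (simp add: R.sum R.scale)
  qed
  have f_sum: "f i (\<Sum>e\<in>E. scale (r e) e) = (\<Sum>e\<in>E. r e * f i e)" if "i \<in> I" for r i
  proof -
    interpret f: module_hom scale "(*)" "f i" by (rule f) fact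
    show ?thesis by (simp add: f.sum f.scale)
  qed
  have "alg_trace scale a = (\<Sum>e\<in>E. ?R (a * e) e)"
    by (simp add: alg_trace_def E_def[symmetric] Let_def)
  \<comment> \<open>This is tr(XY) = tr(YX) for the matrices that pass between the basis
    \<open>E\<close> and the family \<open>b\<close>: expand \<open>e\<close> in the family here,
    swap the sums, then recombine the expansion of \<open>a * b i\<close> in
    \<open>E\<close>.\<close>
  also have "\<dots> = (\<Sum>e\<in>E. \<Sum>i\<in>I. f i e * ?R (a * b i) e)"
  proof (rule sum.cong[OF refl])
    fix e
    have "a * e = (\<Sum>i\<in>I. scale (f i e) (a * b i))"
      by (subst gen[of e]) (simp add: sum_distrib_left mult_scale_right)
    then show "?R (a * e) e = (\<Sum>i\<in>I. f i e * ?R (a * b i) e)"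
      by (simp add: R_sum)
  qed
  also have "\<dots> = (\<Sum>i\<in>I. \<Sum>e\<in>E. ?R (a * b i) e * f i e)"
    by (subst sum.swap) (simp add: mult.commute)
  also have "\<dots> = (\<Sum>i\<in>I. f i (a * b i))"
    by (intro sum.cong refl) (simp add: f_sum[symmetric] E(2))
  finally show ?thesis .
qed

end

section \<open>Free algebras of finite rank over the p-adic integers\<close>

locale padic_free_algebra = comm_algebra scale
  for scale :: "'p::prime_card padic_int \<Rightarrow> 'a::comm_ring_1 \<Rightarrow> 'a" +
  fixes E :: "'a set"
  assumes basis: "is_finite_basis scale E"
begin

abbreviation Tr :: "'a \<Rightarrow> 'p padic_int" where "Tr \<equiv> alg_trace scale"

abbreviation coord :: "'a \<Rightarrow> 'a \<Rightarrow> 'p padic_int" where "coord \<equiv> representation E"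

lemmas finite_basis = is_finite_basisD(1)[OF module_axioms basis]
lemmas sum_coord = is_finite_basisD(2)[OF module_axioms basis]
lemmas module_hom_coord = is_finite_basisD(3)[OF module_axioms basis]

lemma coord_simps:
  "coord (a + b) e = coord a e + coord b e"
  "coord (a - b) e = coord a e - coord b e"
  "coord (scale r a) e = r * coord a e"
  "coord (sum g I) e = (\<Sum>i\<in>I. coord (g i) e)"
proof -
  interpret R: module_hom scale "(*)" "\<lambda>v. coord v e" by (rule module_hom_coord)
  show "coord (a + b) e = coord a e + coord b e"
    "coord (a - b) e = coord a e - coord b e"
    "coord (scale r a) e = r * coord a e"
    "coord (sum g I) e = (\<Sum>i\<in>I. coord (g i) e)"
    by (rule R.add R.diff R.scale R.sum)+
qed

lemma scale_of_nat: "scale (of_nat n) a = of_nat n * a"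
  by (induction n) (simp_all add: scale_left_distrib distrib_right)

lemma scale_of_int: "scale (of_int n) a = of_int n * a"
  by (cases n rule: int_cases2) (simp_all add: scale_of_nat)

lemma scale_prime_power: "scale (of_nat CARD('p) ^ k) a = of_nat CARD('p) ^ k * a"
  using scale_of_nat[of "CARD('p) ^ k" a] by simp

text \<open>Carries separatedness, completeness and finiteness of residue rings from the p-adic
  integers to the algebra, one coordinate at a time.\<close>

lemma prime_power_dvd_iff_coord: "of_nat CARD('p) ^ k dvd a \<longleftrightarrow> (\<forall>e\<in>E. of_nat CARD('p) ^ k dvd coord a e)"
proof
  assume "of_nat CARD('p) ^ k dvd a"
  then obtain b where "a = of_nat CARD('p) ^ k * b" ..
  then have "a = scale (of_nat CARD('p) ^ k) b"
    by (simp add: scale_prime_power)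
  then show "\<forall>e\<in>E. of_nat CARD('p) ^ k dvd coord a e"
    by (simp add: coord_simps)
next
  assume "\<forall>e\<in>E. of_nat CARD('p) ^ k dvd coord a e"
  then obtain g where g: "\<And>e. e \<in> E \<Longrightarrow> coord a e = of_nat CARD('p) ^ k * g e"
    unfolding dvd_def by metis
  have "a = (\<Sum>e\<in>E. scale (coord a e) e)"
    by (simp add: sum_coord)
  also have "\<dots> = (\<Sum>e\<in>E. of_nat CARD('p) ^ k * scale (g e) e)"
    by (intro sum.cong refl) (simp add: g scale_prime_power flip: scale_scale)
  also have "\<dots> = of_nat CARD('p) ^ k * (\<Sum>e\<in>E. scale (g e) e)"
    by (simp add: sum_distrib_left)
  finally show "of_nat CARD('p) ^ k dvd a" ..
qed

lemma coord_sum_basis: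
  assumes "e \<in> E"
  shows "coord (\<Sum>v\<in>E. scale (g v) v) e = g e"
proof -
  have "coord (\<Sum>v\<in>E. scale (g v) v) e = (\<Sum>v\<in>E. g v * (if e = v then 1 else 0))"
    using basis by (auto simp: coord_simps is_finite_basis_def representation_basis intro!: sum.cong)
  also have "\<dots> = g e"
    using assms finite_basis by (simp add: if_distrib[of "\<lambda>x. _ * x"] cong: if_cong)
  finally show ?thesis .
qed

text \<open>The coordinates converge by \<open>padic_int_complete\<close>. An element divisible by
  all powers of the prime has zero coordinates, so the limit is unique and the description in
  \<open>p_adic_limit\<close> denotes it.\<close>

lemma p_adic_limit_dvd:
  fixes S :: "nat \<Rightarrow> 'a"
  assumes S: "\<And>n. of_nat CARD('p) ^ n dvd S (Suc n) - S n"
  shows "of_nat CARD('p) ^ n dvd S n - p_adic_limit CARD('p) S"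
proof -
  have "\<exists>L. \<forall>n. of_nat CARD('p) ^ n dvd coord (S n) e - L" if "e \<in> E" for e
    using S that by (intro padic_int_complete) (simp add: prime_power_dvd_iff_coord coord_simps)
  then obtain l where l: "\<And>e n. e \<in> E \<Longrightarrow> of_nat CARD('p) ^ n dvd coord (S n) e - l e"
    by metis
  define L where "L = (\<Sum>e\<in>E. scale (l e) e)"
  have L: "of_nat CARD('p) ^ n dvd S n - L" for n
    using l by (simp add: prime_power_dvd_iff_coord coord_simps(2) coord_sum_basis L_def)
  have S_le: "of_nat CARD('p) ^ k dvd S n - S k" if "k \<le> n" for n k
    using that
  proof (induction n rule: dec_induct)
    case (step n)
    have "(of_nat CARD('p) :: 'a) ^ k dvd of_nat CARD('p) ^ n"
      using step by (simp add: le_imp_power_dvd)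
    then have "of_nat CARD('p) ^ k dvd (S (Suc n) - S n) + (S n - S k)"
      using S[of n] step.IH by (meson dvd_add dvd_trans)
    then show ?case by simp
  qed simp
  have "p_adic_limit CARD('p) S = L"
    unfolding p_adic_limit_def
  proof (rule the_equality)
    show "\<forall>k. \<exists>N. \<forall>n\<ge>N. of_nat CARD('p) ^ k dvd S n - L"
    proof (intro allI exI impI)
      fix k n :: nat
      assume "k \<le> n"
      then have "of_nat CARD('p) ^ k dvd (S n - S k) + (S k - L)"
        using S_le L by (intro dvd_add)
      then show "of_nat CARD('p) ^ k dvd S n - L" by simp
    qed
  next
    fix L'
    assume L': "\<forall>k. \<exists>N. \<forall>n\<ge>N. of_nat CARD('p) ^ k dvd S n - L'"
    have "of_nat CARD('p) ^ k dvd L' - L" for k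
    proof -
      from L' obtain N where "\<And>n. n \<ge> N \<Longrightarrow> of_nat CARD('p) ^ k dvd S n - L'" by blast
      then have 1: "of_nat CARD('p) ^ k dvd S (max N k) - L'" by simp
      have 2: "of_nat CARD('p) ^ k dvd S (max N k) - S k" by (rule S_le) simp
      have "of_nat CARD('p) ^ k dvd (S (max N k) - S k) + (S k - L) - (S (max N k) - L')"
        by (rule dvd_diff[OF dvd_add[OF 2 L] 1])
      then show ?thesis by simp
    qed
    then have "coord (L' - L) e = 0" if "e \<in> E" for e
      using that by (intro padic_int_eq_0I) (simp add: prime_power_dvd_iff_coord)
    then have "L' - L = 0"
      using sum_coord[of "L' - L"] by (metis (no_types, lifting) scale_zero_left sum.neutral)
    then show "L' = L" by simp
  qed
  with L show ?thesis by simp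
qed

text \<open>The basis chosen inside \<open>alg_trace\<close> may differ from \<open>E\<close>; the
  dual basis lemma with \<open>E\<close> as generating family bridges the two.\<close>

lemma Tr_coord: "Tr a = (\<Sum>e\<in>E. coord (a * e) e)"
  by (rule alg_trace_dual_basis[OF basis finite_basis]) (simp_all add: module_hom_coord sum_coord)

lemma Tr_simps:
  "Tr (a + b) = Tr a + Tr b"
  "Tr (a - b) = Tr a - Tr b"
  "Tr (scale r a) = r * Tr a"
  by (simp_all add: Tr_coord distrib_right left_diff_distrib coord_simps sum.distrib sum_subtractf
      sum_distrib_left flip: scale_mult_left)

lemma Tr_prime_power: "Tr (of_nat CARD('p) ^ k * a) = of_nat CARD('p) ^ k * Tr a"
  by (simp add: Tr_simps flip: scale_prime_power)

lemma Tr_prime: "Tr (of_nat CARD('p) * a) = of_nat CARD('p) * Tr a"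
  using Tr_prime_power[of 1 a] by simp

lemma Tr_dvd: "of_nat CARD('p) ^ k dvd a \<Longrightarrow> of_nat CARD('p) ^ k dvd Tr a"
  by (auto simp: Tr_prime_power elim!: dvdE)

lemma module_hom_Tr: "Modules.module_hom scale (*) (\<lambda>b. Tr (a * b))"
  by unfold_locales (simp_all add: Tr_simps distrib_left mult_scale_right algebra_simps)

text \<open>The trace commutes with reduction modulo p. The coordinate functions of \<open>E\<close>
  descend to \<open>A/pA\<close>, and the images of \<open>E\<close> generate it; by the dual basis
  lemma this computes the trace there without showing that these images are independent.\<close>

lemma alg_trace_red:
  "alg_trace red_scale (red_mod_p a :: ('a, 'p) red_alg) = padic_mod_p (Tr a)"
proof -
  interpret B: comm_algebra "red_scale :: 'p mod_ring \<Rightarrow> ('a, 'p) red_alg \<Rightarrow> _"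
    by (rule comm_algebra_red_scale)
  interpret V: vector_space "red_scale :: 'p mod_ring \<Rightarrow> ('a, 'p) red_alg \<Rightarrow> _"
    by unfold_locales (simp_all add: B.scale_left_distrib B.scale_right_distrib)
  define f :: "'a \<Rightarrow> ('a, 'p) red_alg \<Rightarrow> 'p mod_ring"
    where "f e b = padic_mod_p (coord (rep_red_alg b) e)" for e b
  \<comment> \<open>Two representatives differ by a multiple of p, hence so do their
    coordinates.\<close>
  have f: "f e (red_mod_p v) = padic_mod_p (coord v e)" if "e \<in> E" for e v
  proof -
    have "of_nat CARD('p) dvd rep_red_alg (red_mod_p v :: ('a, 'p) red_alg) - v"
      by (simp flip: red_mod_p_eq_iff)
    then have "of_nat CARD('p) dvd coord (rep_red_alg (red_mod_p v :: ('a, 'p) red_alg) - v) e"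
      using prime_power_dvd_iff_coord[of 1] that by simp
    then show ?thesis
      by (simp add: f_def coord_simps flip: padic_mod_p_eq_0_iff)
  qed
  have red_scale: "red_scale (padic_mod_p r) (red_mod_p v) = (red_mod_p (scale r v) :: ('a, 'p) red_alg)"
    for r v
  proof -
    have "padic_mod_p (of_int (to_int_mod_ring (padic_mod_p r)) - r) = 0"
      by (simp add: of_int_of_int_mod_ring)
    then obtain q where "of_int (to_int_mod_ring (padic_mod_p r)) - r = of_nat CARD('p) * q"
      unfolding padic_mod_p_eq_0_iff by (rule dvdE)
    then have "of_int (to_int_mod_ring (padic_mod_p r)) * v - scale r v = of_nat CARD('p) * scale q v"
      by (metis scale_left_diff_distrib scale_of_int scale_of_nat scale_scale)
    then have "of_nat CARD('p) dvd of_int (to_int_mod_ring (padic_mod_p r)) * v - scale r v" ..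
    then show ?thesis
      by (simp add: red_scale_def times_red_alg.abs_eq red_mod_p_eq_iff)
  qed
  have gen: "b = (\<Sum>e\<in>E. red_scale (f e b) (red_mod_p e))" for b :: "('a, 'p) red_alg"
  proof -
    obtain v where "b = red_mod_p v" using red_mod_p_surj by metis
    then show ?thesis
      by (simp add: f red_scale red_mod_p_sum sum_coord)
  qed
  have hom: "Modules.module_hom red_scale (*) (f e)" if e: "e \<in> E" for e
  proof unfold_locales
    fix b c :: "('a, 'p) red_alg" and r :: "'p mod_ring"
    obtain v w where v: "b = red_mod_p v" and w: "c = red_mod_p w"
      using red_mod_p_surj by metis
    obtain z where z: "padic_mod_p z = r" using padic_mod_p_surj by blast
    show "f e (b + c) = f e b + f e c"
      by (simp add: v w plus_red_alg.abs_eq f[OF e] coord_simps)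
    show "f e (red_scale r b) = r * f e b"
      by (simp add: v red_scale f[OF e] coord_simps flip: z)
  qed (simp_all add: algebra_simps)
  have span: "B.span (red_mod_p ` E) = (UNIV :: ('a, 'p) red_alg set)"
  proof -
    have "b \<in> B.span (red_mod_p ` E)" for b :: "('a, 'p) red_alg"
      by (subst gen) (intro B.span_sum B.span_scale B.span_base imageI)
    then show ?thesis by blast
  qed
  \<comment> \<open>Over a field a finite generating set contains a basis; \<open>G\<close> serves
    only as the finite basis whose existence the dual basis lemma asks for.\<close>
  obtain G :: "('a, 'p) red_alg set" where G: "G \<subseteq> red_mod_p ` E" "B.independent G" "red_mod_p ` E \<subseteq> B.span G"
    using V.maximal_independent_subset by blast
  have "B.span G = UNIV"
    using B.span_mono[OF G(3)] span by (simp add: top.extremum_unique B.span_span)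
  with G finite_basis have "is_finite_basis red_scale G"
    by (auto simp: is_finite_basis_def intro: finite_subset)
  from B.alg_trace_dual_basis[OF this finite_basis hom gen]
  have "alg_trace red_scale (red_mod_p a :: ('a, 'p) red_alg) =
      (\<Sum>e\<in>E. f e (red_mod_p a * red_mod_p e))" .
  also have "\<dots> = padic_mod_p (Tr a)"
    by (simp add: times_red_alg.abs_eq f Tr_coord)
  finally show ?thesis .
qed

end

section \<open>Lifts, dual elements and the binomial series\<close>

text \<open>The digit of \<open>z / p^k\<close> depends on \<open>z\<close> modulo
  \<open>p^(k+1)\<close> only. With \<open>k = 2\<close> and \<open>k = 1\<close> this makes the two
  digits of a class modulo \<open>p^3\<close> well defined.\<close>

lemma padic_quot_mod_p_cong:
  fixes a b :: "'p::prime_card padic_int"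
  assumes "of_nat CARD('p) ^ k dvd a" "of_nat CARD('p) ^ Suc k dvd a - b"
  shows "padic_quot_mod_p k a = padic_quot_mod_p k b"
proof -
  obtain q where q: "a = of_nat CARD('p) ^ k * q" using assms(1) ..
  obtain r where "a - b = of_nat CARD('p) ^ Suc k * r" using assms(2) ..
  then have "b = of_nat CARD('p) ^ k * (q - of_nat CARD('p) * r)"
    by (simp add: q algebra_simps)
  then show ?thesis
    unfolding q by (simp only: padic_quot_mod_p_mult) simp
qed

text \<open>Translates survival to precision \<open>p^3\<close> into the vanishing of a digit, that
  is, into a root of the branch polynomial.\<close>

lemma padic_quot_mod_p_eq_0_iff:
  fixes a :: "'p::prime_card padic_int"
  assumes "of_nat CARD('p) ^ k dvd a"
  shows "padic_quot_mod_p k a = 0 \<longleftrightarrow> of_nat CARD('p) ^ Suc k dvd a"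
proof -
  obtain q where q: "a = of_nat CARD('p) ^ k * q" using assms ..
  show ?thesis
    unfolding q padic_quot_mod_p_mult padic_mod_p_eq_0_iff
    by (auto simp: dvd_def padic_prime_power_mult_cancel mult.assoc mult.left_commute[of "of_nat CARD('p)"])
qed

lemma padic_binomial_simps:
  fixes T :: "'p::prime_card padic_int"
  assumes "odd CARD('p)"
  shows "padic_binomial T 0 = 1" "padic_binomial T 1 = T" "2 * padic_binomial T 2 = T * (T - 1)"
proof -
  show "padic_binomial T 0 = 1" "padic_binomial T 1 = T"
    by (simp_all add: padic_binomial_def)
  obtain h :: "'p padic_int" where h: "2 * h = 1"
    using assms by (rule padic_half)
  have "padic_binomial T 2 = h * (T * (T - 1))"
    unfolding padic_binomial_def
  proof (rule the_equality)
    have "2 * (h * (T * (T - 1))) = T * (T - 1)"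
      using h by (simp flip: mult.assoc)
    then show "of_nat (fact 2) * (h * (T * (T - 1))) = (\<Prod>i<2. T - of_nat i)"
      by (simp add: numeral_2_eq_2)
    fix b
    assume "of_nat (fact 2) * b = (\<Prod>i<2. T - of_nat i)"
    then have "2 * b = T * (T - 1)"
      by (simp add: numeral_2_eq_2)
    then show "b = h * (T * (T - 1))"
      using h by (metis mult.assoc mult.commute mult_1)
  qed
  then show "2 * padic_binomial T 2 = T * (T - 1)"
    using h by (simp flip: mult.assoc)
qed

context padic_free_algebra
begin

text \<open>Nondegeneracy of the trace form modulo p. The map
  \<open>z \<mapsto> Tr (w * z) / p\<close> is linear, hence equals \<open>Tr (w' * z)\<close> for
  some \<open>w'\<close> by surjectivity, and injectivity gives \<open>w = p w'\<close>.\<close>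

lemma prime_dvd_if_prime_dvd_traces:
  assumes etale: "bij_betw (\<lambda>a b. Tr (a * b)) UNIV {f. Modules.module_hom scale (*) f}"
    and w: "\<And>z. of_nat CARD('p) dvd Tr (w * z)"
  shows "of_nat CARD('p) dvd w"
proof -
  obtain g where g: "\<And>z. Tr (w * z) = of_nat CARD('p) * g z"
    using w unfolding dvd_def by metis
  have cancel: "u = v" if "of_nat CARD('p) * u = of_nat CARD('p) * v" for u v :: "'p padic_int"
    using that padic_prime_power_mult_cancel[of 1 u v] by simp
  interpret W: module_hom scale "(*)" "\<lambda>z. Tr (w * z)"
    by (rule module_hom_Tr)
  have "Modules.module_hom scale (*) g"
  proof unfold_locales
    show "g (a + b) = g a + g b" for a b
      by (rule cancel) (simp add: distrib_left Tr_simps flip: g)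
    show "g (scale r a) = r * g a" for r a
      by (rule cancel) (metis W.scale g mult.left_commute)
  qed
  then have "g \<in> range (\<lambda>a b. Tr (a * b))"
    using etale by (simp add: bij_betw_def)
  then obtain w' where w': "g = (\<lambda>b. Tr (w' * b))" by blast
  have "(\<lambda>b. Tr (w * b)) = (\<lambda>b. Tr (of_nat CARD('p) * w' * b))"
    by (simp add: g w' mult.assoc Tr_prime)
  then have "w = of_nat CARD('p) * w'"
    using etale by (auto simp: bij_betw_def dest: injD)
  then show ?thesis ..
qed

text \<open>The second element is normalised modulo the square of the prime, so that adding a multiple
  of it does not disturb the constant digit.\<close>

lemma dual_pair:
  assumes etale: "bij_betw (\<lambda>a b. Tr (a * b)) UNIV {f. Modules.module_hom scale (*) f}"
    and nontriv: "\<not> of_nat CARD('p) dvd (1 :: 'a)"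
    and nonscalar: "\<And>k. \<not> of_nat CARD('p) dvd U - scale k 1"
  obtains z\<^sub>1 z\<^sub>2 where
    "padic_mod_p (Tr z\<^sub>1) = 1" "padic_mod_p (Tr (z\<^sub>1 * U)) = 0"
    "of_nat CARD('p) ^ 2 dvd Tr z\<^sub>2" "padic_mod_p (Tr (z\<^sub>2 * U)) = 1"
proof -
  let ?t = "\<lambda>z. padic_mod_p (Tr z)" and ?v = "\<lambda>z. padic_mod_p (Tr (z * U))"
  note tr = Tr_simps left_diff_distrib scale_mult_left[symmetric]
  obtain z where z: "?t z \<noteq> 0"
    using prime_dvd_if_prime_dvd_traces[OF etale, of 1] nontriv padic_mod_p_eq_0_iff by auto
  obtain r where r: "padic_mod_p r = inverse (?t z)"
    by (rule padic_mod_p_surj)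
  define z0 where "z0 = scale r z"
  have t0: "?t z0 = 1"
    using z by (simp add: z0_def tr r)
  \<comment> \<open>As \<open>z0\<close> has trace 1 modulo p, this number is the determinant of the
    functionals \<open>?t\<close> and \<open>?v\<close> on the pair \<open>z0\<close>,
    \<open>z'\<close>. Its nonvanishing allows Gaussian elimination below.\<close>
  obtain z' where z': "padic_mod_p (Tr ((U - scale (Tr (z0 * U)) 1) * z')) \<noteq> 0"
    using prime_dvd_if_prime_dvd_traces[OF etale] nonscalar padic_mod_p_eq_0_iff by blast
  then have z': "?v z' - ?v z0 * ?t z' \<noteq> 0"
    by (simp add: tr mult.commute[of U])
  define z'' where "z'' = z' - scale (Tr z') z0"
  have t'': "?t z'' = 0" and v'': "?v z'' \<noteq> 0"
    using z' t0 by (simp_all add: z''_def tr mult.commute[of "padic_mod_p (Tr z')"])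
  obtain r' where r': "padic_mod_p r' = inverse (?v z'')"
    by (rule padic_mod_p_surj)
  define z3 where "z3 = scale r' z''"
  have t3: "?t z3 = 0" and v3: "?v z3 = 1"
    using t'' v'' by (simp_all add: z3_def tr r')
  define z1 where "z1 = z0 - scale (Tr (z0 * U)) z3"
  have t1: "?t z1 = 1" and v1: "?v z1 = 0"
    using t0 t3 v3 by (simp_all add: z1_def tr)
  obtain m where m: "Tr z3 = of_nat CARD('p) * m"
    using t3 unfolding padic_mod_p_eq_0_iff ..
  \<comment> \<open>The correction leaves trace \<open>p m (1 - Tr z1)\<close>, and
    \<open>Tr z1\<close> being 1 modulo p supplies the second factor p.\<close>
  define z2 where "z2 = z3 - scale (of_nat CARD('p) * m) z1"
  have "padic_mod_p (1 - Tr z1) = 0"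
    by (simp add: t1)
  then obtain n where n: "1 - Tr z1 = of_nat CARD('p) * n"
    unfolding padic_mod_p_eq_0_iff ..
  have "Tr z2 = of_nat CARD('p) * m * (1 - Tr z1)"
    by (simp add: z2_def tr m algebra_simps)
  then have "Tr z2 = of_nat CARD('p) ^ 2 * (m * n)"
    unfolding n by (simp add: power2_eq_square algebra_simps)
  then have "of_nat CARD('p) ^ 2 dvd Tr z2" ..
  moreover have "?v z2 = 1"
    by (simp add: z2_def tr v3)
  ultimately show ?thesis
    using that t1 v1 by blast
qed

section \<open>Residue classes modulo the cube of p and truncation of the series\<close>

definition class_mod_p3 :: "'a \<Rightarrow> 'a set"
  where "class_mod_p3 a = {b. of_nat CARD('p) ^ 3 dvd a - b}"

lemma class_mod_p3_eq_iff: "class_mod_p3 a = class_mod_p3 b \<longleftrightarrow> of_nat CARD('p) ^ 3 dvd a - b"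
proof
  assume "class_mod_p3 a = class_mod_p3 b"
  moreover have "b \<in> class_mod_p3 b" by (simp add: class_mod_p3_def)
  ultimately show "of_nat CARD('p) ^ 3 dvd a - b"
    by (auto simp: class_mod_p3_def)
next
  assume *: "of_nat CARD('p) ^ 3 dvd a - b"
  have "of_nat CARD('p) ^ 3 dvd a - d \<longleftrightarrow> of_nat CARD('p) ^ 3 dvd b - d" for d
    using dvd_add_right_iff[OF *, of "b - d"] by simp
  then show "class_mod_p3 a = class_mod_p3 b"
    by (simp add: class_mod_p3_def)
qed

lemma lifts_mod_p3_iff:
  "y \<in> lifts_mod_p3 (x :: ('a, 'p) red_alg) \<longleftrightarrow> (\<exists>a. y = class_mod_p3 a \<and> red_mod_p a = x)"
proof -
  have quot: "UNIV // {(a, b). of_nat CARD('p) ^ 3 dvd a - b} = range class_mod_p3"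
    by (auto simp: quotient_def class_mod_p3_def)
  have "red_mod_p ` class_mod_p3 a = {red_mod_p a :: ('a, 'p) red_alg}" for a
  proof -
    have "(red_mod_p b :: ('a, 'p) red_alg) = red_mod_p a" if "b \<in> class_mod_p3 a" for b
    proof -
      have "of_nat CARD('p) dvd a - b"
        using that by (auto simp: class_mod_p3_def intro: dvd_trans[rotated])
      then show ?thesis by (metis red_mod_p_eq_iff)
    qed
    moreover have "a \<in> class_mod_p3 a" by (simp add: class_mod_p3_def)
    ultimately show ?thesis by blast
  qed
  then show ?thesis
    by (auto simp: lifts_mod_p3_def quot)
qed

text \<open>Each class is determined by the coordinates of a lift modulo \<open>p^3\<close>. The
  coordinate functions are restricted to \<open>E\<close> so that they range over a finite function
  space.\<close>

lemma finite_lifts_mod_p3: "finite (lifts_mod_p3 (x :: ('a, 'p) red_alg))"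
proof (rule finite_subset)
  let ?F = "E \<rightarrow>\<^sub>E {0..<int CARD('p) ^ 3}"
  let ?c = "\<lambda>g. class_mod_p3 (\<Sum>e\<in>E. scale (of_int (g e)) e)"
  show "finite (?c ` ?F)"
    by (intro finite_imageI finite_PiE finite_basis) simp
  show "lifts_mod_p3 x \<subseteq> ?c ` ?F"
  proof
    fix y
    assume "y \<in> lifts_mod_p3 x"
    then obtain a where y: "y = class_mod_p3 a"
      by (auto simp: lifts_mod_p3_iff)
    have "\<exists>i q. i \<in> {0..<int CARD('p) ^ 3} \<and> coord a e = of_int i + of_nat CARD('p) ^ 3 * q" for e
      by (rule padic_int_cases_mod) blast
    then obtain g q where g: "\<And>e. g e \<in> {0..<int CARD('p) ^ 3}"
      and q: "\<And>e. coord a e = of_int (g e) + of_nat CARD('p) ^ 3 * q e"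
      by metis
    have eq: "(\<Sum>e\<in>E. scale (of_int (restrict g E e)) e) = (\<Sum>e\<in>E. scale (of_int (g e)) e)"
      by (intro sum.cong) simp_all
    have "of_nat CARD('p) ^ 3 dvd a - (\<Sum>e\<in>E. scale (of_int (g e)) e)"
      by (simp add: prime_power_dvd_iff_coord coord_simps(2) coord_sum_basis q)
    then have "y = ?c (restrict g E)"
      by (simp only: eq y class_mod_p3_eq_iff)
    moreover have "restrict g E \<in> ?F"
      using g by auto
    ultimately show "y \<in> ?c ` ?F" by blast
  qed
qed

text \<open>Term \<open>n\<close> carries the factor \<open>p^n\<close> whatever its binomial
  coefficient, so the rate in \<open>p_adic_limit_dvd\<close> at index 3 leaves the terms 0, 1 and
  2.\<close>

lemma one_plus_p_pow_mod_p3: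
  assumes "odd CARD('p)"
  shows "of_nat CARD('p) ^ 3 dvd 1 + scale T (of_nat CARD('p) * U) +
    scale (padic_binomial T 2) (of_nat CARD('p) ^ 2 * U ^ 2) - one_plus_p_pow scale U T"
proof -
  let ?S = "\<lambda>N. \<Sum>n<N. scale (padic_binomial T n) ((of_nat CARD('p) * U) ^ n)"
  have "of_nat CARD('p) ^ n dvd ?S (Suc n) - ?S n" for n
    by (simp add: power_mult_distrib flip: mult_scale_right)
  from p_adic_limit_dvd[of ?S, OF this, of 3]
  have "of_nat CARD('p) ^ 3 dvd ?S 3 - one_plus_p_pow scale U T"
    by (simp only: one_plus_p_pow_def)
  moreover have "?S 3 = 1 + scale T (of_nat CARD('p) * U) +
      scale (padic_binomial T 2) (of_nat CARD('p) ^ 2 * U ^ 2)"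
    using padic_binomial_simps(1,2)[OF assms, of T]
    by (simp add: eval_nat_numeral power_mult_distrib algebra_simps)
  ultimately show ?thesis by simp
qed

end

section \<open>Squares, quadratics and the distribution of branches\<close>

lemma two_neq_0_mod_ring:
  assumes "odd CARD('p)"
  shows "(2 :: 'p::prime_card mod_ring) \<noteq> 0"
proof
  assume "(2 :: 'p mod_ring) = 0"
  then have "of_nat 2 = (0 :: 'p mod_ring)" by simp
  then have "CARD('p) dvd 2" by (rule of_nat_0_mod_ring_dvd)
  then have "CARD('p) \<le> 2" by (simp add: dvd_imp_le)
  moreover have "CARD('p) > 1"
    using prime_card[where ?'a='p] prime_gt_1_nat by blast
  ultimately have "CARD('p) = 2" by linarith
  with assms show False by simp
qed

text \<open>Squaring is two-to-one on the nonzero elements, because \<open>r\<close> and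
  \<open>- r\<close> differ when 2 is nonzero.\<close>

lemma card_nonzero_squares:
  assumes "(2 :: 'k::{field,finite}) \<noteq> 0"
  shows "2 * card {d :: 'k. d \<noteq> 0 \<and> is_square d} = CARD('k) - 1"
proof -
  let ?S = "- {0} :: 'k set"
  have image: "(\<lambda>r. r\<^sup>2) ` ?S = {d. d \<noteq> 0 \<and> is_square d}"
    by (auto simp: is_nth_power_def)
  have fiber: "card {r \<in> ?S. r\<^sup>2 = d} = 2" if d: "d \<in> (\<lambda>r. r\<^sup>2) ` ?S" for d
  proof -
    obtain r where r: "d = r\<^sup>2" "r \<noteq> 0" using d by auto
    have "r \<noteq> - r"
    proof
      assume "r = - r"
      then have "r + r = 0" by (metis add.right_inverse)
      then have "2 * r = 0" by simp
      with assms r show False by simp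
    qed
    moreover have "{s \<in> ?S. s\<^sup>2 = d} = {r, - r}"
      using r by (auto simp: power2_eq_iff)
    ultimately show ?thesis by simp
  qed
  have "CARD('k) - 1 = (\<Sum>r\<in>?S. 1)"
    by (simp add: Compl_eq_Diff_UNIV card_Diff_singleton)
  also have "\<dots> = (\<Sum>d\<in>(\<lambda>r. r\<^sup>2) ` ?S. \<Sum>r\<in>{r \<in> ?S. r\<^sup>2 = d}. 1)"
    by (rule sum.image_gen) simp
  also have "\<dots> = (\<Sum>d\<in>(\<lambda>r. r\<^sup>2) ` ?S. 2)"
    by (intro sum.cong refl) (use fiber in simp)
  finally show ?thesis
    by (simp add: image)
qed

lemma quadratic_discriminant_cases:
  fixes q :: "'k::field poly"
  assumes two: "(2 :: 'k) \<noteq> 0" and deg: "degree q = 2"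
  shows "\<not> is_square (quadratic_disc q) \<Longrightarrow> {t. poly q t = 0} = {}"
    and "quadratic_disc q \<noteq> 0 \<Longrightarrow> is_square (quadratic_disc q) \<Longrightarrow>
      card {t. poly q t = 0} = 2 \<and> (\<forall>t\<in>{t. poly q t = 0}. Polynomial.order t q = 1)"
    and "quadratic_disc q = 0 \<Longrightarrow> \<exists>t. {t. poly q t = 0} = {t} \<and> Polynomial.order t q = 2"
proof -
  define a b c where "a = Polynomial.coeff q 2" and "b = Polynomial.coeff q 1"
    and "c = Polynomial.coeff q 0"
  have D: "quadratic_disc q = b\<^sup>2 - 4 * a * c"
    by (simp add: quadratic_disc_def a_def b_def c_def)
  have a: "a \<noteq> 0"
    using deg by (metis a_def degree_0 leading_coeff_0_iff zero_neq_numeral)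
  have four: "(4 :: 'k) \<noteq> 0"
  proof -
    have "(4 :: 'k) = 2 * 2" by simp
    with two show ?thesis by (simp only: mult_eq_0_iff) simp
  qed
  have q: "q = [:c, b, a:]"
  proof (rule poly_eqI)
    fix n :: nat
    consider "n = 0" | "n = 1" | "n = 2" | "n > 2" by linarith
    then show "Polynomial.coeff q n = Polynomial.coeff [:c, b, a:] n"
      by cases (use deg in \<open>auto simp: a_def b_def c_def coeff_eq_0 numeral_2_eq_2\<close>)
  qed
  \<comment> \<open>The quadratic formula as a factorisation; \<open>r = 0\<close> covers the double
    root.\<close>
  have factor: "q = smult a ([:- ((- b + r) / (2 * a)), 1:] * [:- ((- b - r) / (2 * a)), 1:])"
    if "quadratic_disc q = r\<^sup>2" for r
  proof -
    define u v where "u = (- b + r) / (2 * a)" and "v = (- b - r) / (2 * a)"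
    have u: "2 * a * u = - b + r" and v: "2 * a * v = - b - r"
      using a two by (simp_all add: u_def v_def)
    have "4 * a * (a * u * v) = (2 * a * u) * (2 * a * v)"
      by simp
    also have "\<dots> = b\<^sup>2 - r\<^sup>2"
      unfolding u v by (simp add: power2_eq_square algebra_simps)
    also have "\<dots> = 4 * a * c"
      using that unfolding D by (simp add: algebra_simps)
    finally have 0: "a * u * v = c"
      using a four by simp
    have "2 * (a * (u + v)) = 2 * a * u + 2 * a * v"
      by (simp add: algebra_simps)
    also have "\<dots> = 2 * (- b)"
      unfolding u v by simp
    finally have "a * (u + v) = - b"
      using two by (simp only: mult_cancel_left) simp
    then have "b = - (a * (u + v))"
      by simp
    then have 1: "b = - (a * u) - a * v"
      by (simp add: distrib_left)
    show ?thesis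
      unfolding q u_def[symmetric] v_def[symmetric] by (simp add: 1 right_diff_distrib flip: 0)
  qed
  show "{t. poly q t = 0} = {}" if "\<not> is_square (quadratic_disc q)"
  proof -
    have "poly q t \<noteq> 0" for t
    proof
      assume "poly q t = 0"
      then have t: "c + t * (b + t * a) = 0"
        unfolding q by simp
      \<comment> \<open>Completing the square: the discriminant is a square minus
        \<open>4 * a\<close> times the value of \<open>q\<close> at \<open>t\<close>, so a root
        makes it a square.\<close>
      have "quadratic_disc q = (2 * a * t + b)\<^sup>2 - 4 * a * (c + t * (b + t * a))"
        unfolding D by (simp add: power2_eq_square algebra_simps)
      then have "quadratic_disc q = (2 * a * t + b)\<^sup>2"
        unfolding t by simp
      with that show False by (metis is_nth_power_nth_power)
    qed
    then show ?thesis by blast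
  qed
  show "card {t. poly q t = 0} = 2 \<and> (\<forall>t\<in>{t. poly q t = 0}. Polynomial.order t q = 1)"
    if nz: "quadratic_disc q \<noteq> 0" and sq: "is_square (quadratic_disc q)"
  proof -
    obtain r where r: "quadratic_disc q = r\<^sup>2" using sq by (auto simp: is_nth_power_def)
    define u v where "u = (- b + r) / (2 * a)" and "v = (- b - r) / (2 * a)"
    have "r \<noteq> 0" using nz r by simp
    have "u - v = r / a"
      using a two four by (simp add: u_def v_def field_simps)
    then have uv: "u \<noteq> v" using \<open>r \<noteq> 0\<close> a by auto
    have q': "q = smult a ([:- u, 1:] * [:- v, 1:])"
      unfolding u_def v_def by (rule factor) fact
    have "poly q t = a * ((t - u) * (t - v))" for t
      unfolding q' poly_smult poly_mult by simp
    then have roots: "{t. poly q t = 0} = {u, v}"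
      using a by auto
    \<comment> \<open>Orders add over the two linear factors; since \<open>u\<close> and
      \<open>v\<close> differ, each root gets 1 from one factor and 0 from the other.\<close>
    have ord: "Polynomial.order t q = Polynomial.order t [:- u, 1:] + Polynomial.order t [:- v, 1:]" for t
    proof -
      have "[:- u, 1:] * [:- v, 1:] \<noteq> 0"
        by (simp only: mult_eq_0_iff) simp
      then show ?thesis
        unfolding q' order_smult[OF a] by (rule order_mult)
    qed
    show ?thesis
      using uv unfolding roots ord by (auto simp: order_0I order_power_n_n[of _ 1, simplified])
  qed
  show "\<exists>t. {t. poly q t = 0} = {t} \<and> Polynomial.order t q = 2" if "quadratic_disc q = 0"
  proof -
    define u where "u = - b / (2 * a)"
    have q': "q = smult a ([:- u, 1:] ^ 2)"
      using factor[of 0] that by (simp add: u_def power2_eq_square)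
    have "{t. poly q t = 0} = {u}"
      unfolding q' using a by auto
    moreover have "Polynomial.order u q = 2"
      unfolding q' using a by (simp add: order_smult order_power_n_n)
    ultimately show ?thesis by blast
  qed
qed

lemma card_Collect_comp_equal_fibers:
  fixes f :: "'b \<Rightarrow> 'c::finite"
  assumes "finite S" and "\<And>b. card {y \<in> S. f y = b} = N"
  shows "card {y \<in> S. P (f y)} = N * card {b. P b}"
proof -
  have "{y \<in> S. P (f y)} = (\<Union>b\<in>{b. P b}. {y \<in> S. f y = b})" by blast
  also have "card \<dots> = (\<Sum>b\<in>{b. P b}. card {y \<in> S. f y = b})"
    by (rule card_UN_disjoint) (use assms in auto)
  also have "\<dots> = N * card {b. P b}"
    by (simp add: assms)
  finally show ?thesis .
qed

section \<open>Surviving lifts and their digits\<close>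

locale branch_setting = padic_free_algebra scale E
  for scale :: "'p::prime_card padic_int \<Rightarrow> 'a::comm_ring_1 \<Rightarrow> 'a" and E +
  fixes x :: "('a, 'p) red_alg" and \<Delta> :: "'p mod_ring" and c :: "'p padic_int" and U :: 'a
  assumes odd_card: "odd CARD('p)"
    and etale: "bij_betw (\<lambda>a b. Tr (a * b)) UNIV {f. Modules.module_hom scale (*) f}"
    and trace_x: "alg_trace red_scale x = padic_mod_p c"
    and trace_Ux: "alg_trace red_scale (red_mod_p U * x) = 0"
    and trace_UUx: "alg_trace red_scale (red_mod_p U ^ 2 * x) = \<Delta>"
    and \<Delta>_nonzero: "\<Delta> \<noteq> 0"
begin

lemma trace_lift:
  assumes "red_mod_p a = x"
  shows "padic_mod_p (Tr a) = padic_mod_p c" "padic_mod_p (Tr (a * U)) = 0"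
    "padic_mod_p (Tr (a * U\<^sup>2)) = \<Delta>"
proof -
  show "padic_mod_p (Tr a) = padic_mod_p c"
    using trace_x by (simp add: alg_trace_red flip: assms)
  show "padic_mod_p (Tr (a * U)) = 0"
    using trace_Ux by (simp add: alg_trace_red times_red_alg.abs_eq mult.commute flip: assms)
  show "padic_mod_p (Tr (a * U\<^sup>2)) = \<Delta>"
    using trace_UUx
    by (simp add: alg_trace_red times_red_alg.abs_eq red_mod_p_power mult.commute flip: assms)
qed

text \<open>Both remaining hypotheses of \<open>dual_pair\<close> follow from \<Delta> being
  nonzero: a unit p would divide every trace, and a scalar \<open>U\<close> modulo p would make
  \<Delta> a multiple of the vanishing trace of \<open>a * U\<close>.\<close>

lemma trace_pair:
  obtains z\<^sub>1 z\<^sub>2 where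
    "padic_mod_p (Tr z\<^sub>1) = 1" "padic_mod_p (Tr (z\<^sub>1 * U)) = 0"
    "of_nat CARD('p) ^ 2 dvd Tr z\<^sub>2" "padic_mod_p (Tr (z\<^sub>2 * U)) = 1"
proof (rule dual_pair[OF etale])
  obtain a where "red_mod_p a = x" by (rule red_mod_p_surj)
  note a = trace_lift[OF this]
  have dvd: "padic_mod_p (Tr b) = 0" if "of_nat CARD('p) dvd b" for b
    using Tr_dvd[of 1 b] that by (simp add: padic_mod_p_eq_0_iff)
  show "\<not> of_nat CARD('p) dvd (1 :: 'a)"
  proof
    assume "of_nat CARD('p) dvd (1 :: 'a)"
    then have "of_nat CARD('p) dvd a * U\<^sup>2"
      using one_dvd dvd_trans by blast
    from dvd[OF this] a(3) \<Delta>_nonzero show False by simp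
  qed
  show "\<not> of_nat CARD('p) dvd U - scale k 1" for k
  proof
    assume "of_nat CARD('p) dvd U - scale k 1"
    then have "of_nat CARD('p) dvd a * U * (U - scale k 1)"
      by simp
    from dvd[OF this] have "padic_mod_p (Tr (a * U\<^sup>2)) = padic_mod_p k * padic_mod_p (Tr (a * U))"
      by (simp add: right_diff_distrib Tr_simps mult_scale_right power2_eq_square mult.assoc)
    with a \<Delta>_nonzero show False by simp
  qed
qed (use that in blast)

lemma class_survivingI:
  assumes "red_mod_p a = x" "of_nat CARD('p) ^ 2 dvd Tr a - c"
  shows "class_mod_p3 a \<in> surviving scale x c"
proof -
  have "of_nat CARD('p) ^ 2 dvd Tr b - c" if "b \<in> class_mod_p3 a" for b
  proof -
    have "of_nat CARD('p) ^ 2 dvd a - b"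
      using that dvd_trans[OF le_imp_power_dvd[of 2 3]] by (auto simp: class_mod_p3_def)
    then have "of_nat CARD('p) ^ 2 dvd Tr a - Tr b"
      using Tr_dvd by (simp flip: Tr_simps)
    then have "of_nat CARD('p) ^ 2 dvd (Tr a - c) - (Tr a - Tr b)"
      using assms by (blast intro: dvd_diff)
    then show ?thesis by simp
  qed
  then show ?thesis
    using assms by (auto simp: surviving_def lifts_mod_p3_iff)
qed

lemma survivingE:
  assumes "y \<in> surviving scale x c"
  obtains a where "a \<in> y"
proof -
  obtain a where "y = class_mod_p3 a"
    using assms by (auto simp: surviving_def lifts_mod_p3_iff)
  then show ?thesis using that[of a] by (simp add: class_mod_p3_def)
qed

lemma survivingD:
  assumes "y \<in> surviving scale x c" "a \<in> y"
  shows "red_mod_p a = x" "of_nat CARD('p) ^ 2 dvd Tr a - c" "y = class_mod_p3 a"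
proof -
  obtain a' where y: "y \<in> lifts_mod_p3 x" "y = class_mod_p3 a'"
    and tr: "of_nat CARD('p) ^ 2 dvd Tr a - c"
    using assms by (auto simp: surviving_def lifts_mod_p3_iff)
  show "of_nat CARD('p) ^ 2 dvd Tr a - c" by fact
  show "red_mod_p a = x"
    using y(1) assms(2) by (auto simp: lifts_mod_p3_def)
  have "of_nat CARD('p) ^ 3 dvd a' - a"
    using assms(2) y(2) by (simp add: class_mod_p3_def)
  then show "y = class_mod_p3 a"
    by (simp add: y(2) class_mod_p3_eq_iff)
qed

lemma finite_surviving: "finite (surviving scale x c)"
  by (rule finite_subset[OF _ finite_lifts_mod_p3[of x]]) (auto simp: surviving_def)

lemma prime_dvd_Tr_mult:
  assumes "y \<in> surviving scale x c" "a \<in> y"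
  shows "of_nat CARD('p) dvd Tr (a * U)"
  using trace_lift(2)[OF survivingD(1)[OF assms]] by (simp add: padic_mod_p_eq_0_iff)

text \<open>All lifts in the class give the same digit, so the image under \<open>the_elem\<close>
  is a singleton.\<close>

lemma A_digit_eq:
  assumes y: "y \<in> surviving scale x c" "a \<in> y"
  shows "A_digit scale c y = padic_quot_mod_p 2 (Tr a - c)"
proof -
  have "padic_quot_mod_p 2 (Tr b - c) = padic_quot_mod_p 2 (Tr a - c)" if "b \<in> y" for b
  proof (rule padic_quot_mod_p_cong[symmetric])
    show "of_nat CARD('p) ^ 2 dvd Tr a - c"
      using survivingD y by blast
    have "of_nat CARD('p) ^ 3 dvd a - b"
      using survivingD(3)[OF y] that by (simp add: class_mod_p3_def)
    from Tr_dvd[OF this] show "of_nat CARD('p) ^ Suc 2 dvd Tr a - c - (Tr b - c)"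
      by (simp add: Tr_simps eval_nat_numeral)
  qed
  then have "(\<lambda>b. padic_quot_mod_p 2 (Tr b - c)) ` y = {padic_quot_mod_p 2 (Tr a - c)}"
    using y(2) by blast
  then show ?thesis by (simp add: A_digit_def)
qed

lemma B_digit_eq:
  assumes y: "y \<in> surviving scale x c" "a \<in> y"
  shows "B_digit scale U y = padic_quot_mod_p 1 (Tr (a * U))"
proof -
  have "padic_quot_mod_p 1 (Tr (b * U)) = padic_quot_mod_p 1 (Tr (a * U))" if "b \<in> y" for b
  proof (rule padic_quot_mod_p_cong[symmetric])
    show "of_nat CARD('p) ^ 1 dvd Tr (a * U)"
      using prime_dvd_Tr_mult[OF y] by simp
    have "of_nat CARD('p) ^ 3 dvd a - b"
      using survivingD(3)[OF y] that by (simp add: class_mod_p3_def)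
    then have "of_nat CARD('p) ^ Suc 1 dvd a - b"
      by (rule dvd_trans[OF le_imp_power_dvd, rotated]) simp
    then have "of_nat CARD('p) ^ Suc 1 dvd (a - b) * U"
      by (rule dvd_mult2)
    from Tr_dvd[OF this] show "of_nat CARD('p) ^ Suc 1 dvd Tr (a * U) - Tr (b * U)"
      by (simp only: left_diff_distrib Tr_simps)
  qed
  then have "(\<lambda>b. padic_quot_mod_p 1 (Tr (b * U))) ` y = {padic_quot_mod_p 1 (Tr (a * U))}"
    using y(2) by blast
  then show ?thesis by (simp add: B_digit_def)
qed

text \<open>Excludes empty fibres and frequencies of the form 0/0.\<close>

lemma surviving_nonempty: "surviving scale x c \<noteq> {}"
proof -
  obtain a where a: "red_mod_p a = x" by (rule red_mod_p_surj)
  obtain z\<^sub>1 z\<^sub>2 where z1: "padic_mod_p (Tr z\<^sub>1) = 1"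
    using trace_pair by metis
  have "padic_mod_p (Tr a - c) = 0"
    by (simp add: trace_lift[OF a])
  then obtain m where m: "Tr a - c = of_nat CARD('p) * m"
    unfolding padic_mod_p_eq_0_iff ..
  have "padic_mod_p (1 - Tr z\<^sub>1) = 0"
    by (simp add: z1)
  then obtain n where n: "1 - Tr z\<^sub>1 = of_nat CARD('p) * n"
    unfolding padic_mod_p_eq_0_iff ..
  \<comment> \<open>One correction step: subtracting \<open>p m\<close> times an element of trace 1
    modulo p turns the error \<open>p m\<close> into \<open>p m (1 - Tr z\<^sub>1)\<close>, a
    multiple of \<open>p^2\<close>.\<close>
  define b where "b = a - of_nat CARD('p) * scale m z\<^sub>1"
  have "of_nat CARD('p) dvd b - a"
    by (simp add: b_def)
  then have "red_mod_p b = x"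
    unfolding a[symmetric] by (simp add: red_mod_p_eq_iff)
  moreover have "Tr b - c = (Tr a - c) - of_nat CARD('p) * m * Tr z\<^sub>1"
    by (simp add: b_def Tr_simps Tr_prime)
  then have "Tr b - c = of_nat CARD('p) * m * (1 - Tr z\<^sub>1)"
    unfolding m by (simp add: algebra_simps)
  then have "Tr b - c = of_nat CARD('p) ^ 2 * (m * n)"
    unfolding n by (simp add: power2_eq_square mult_ac)
  then have "of_nat CARD('p) ^ 2 dvd Tr b - c" ..
  ultimately show ?thesis
    using class_survivingI by blast
qed

text \<open>Translation by a suitable multiple of the prime maps any fibre injectively into any other.\<close>

lemma card_fiber_le:
  "card {y \<in> surviving scale x c. A_digit scale c y = \<alpha> \<and> B_digit scale U y = \<beta>} \<le>
   card {y \<in> surviving scale x c. A_digit scale c y = \<alpha>' \<and> B_digit scale U y = \<beta>'}"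
proof -
  obtain z\<^sub>1 z\<^sub>2 where z: "padic_mod_p (Tr z\<^sub>1) = 1" "padic_mod_p (Tr (z\<^sub>1 * U)) = 0"
    "of_nat CARD('p) ^ 2 dvd Tr z\<^sub>2" "padic_mod_p (Tr (z\<^sub>2 * U)) = 1"
    by (rule trace_pair)
  obtain m where m: "Tr z\<^sub>2 = of_nat CARD('p) ^ 2 * m" using z(3) ..
  obtain a' where a': "padic_mod_p a' = \<alpha>' - \<alpha>" by (rule padic_mod_p_surj)
  obtain b' where b': "padic_mod_p b' = \<beta>' - \<beta>" by (rule padic_mod_p_surj)
  \<comment> \<open>The part with \<open>z\<^sub>1\<close> has weight \<open>p^2\<close>: it moves
    the constant digit by \<open>a'\<close> and is invisible to the linear digit. The part with
    \<open>z\<^sub>2\<close> has weight p: it moves the linear digit by \<open>b'\<close>, while its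
    trace is divisible by \<open>p^3\<close>.\<close>
  define \<delta> where "\<delta> = of_nat CARD('p) * (of_nat CARD('p) * scale a' z\<^sub>1 + scale b' z\<^sub>2)"
  have Tr_\<delta>: "Tr \<delta> = of_nat CARD('p) ^ 2 * (a' * Tr z\<^sub>1 + of_nat CARD('p) * (b' * m))"
    by (simp add: \<delta>_def Tr_prime Tr_simps m power2_eq_square algebra_simps)
  have Tr_\<delta>U: "Tr (\<delta> * U) = of_nat CARD('p) ^ 1 *
      (of_nat CARD('p) * (a' * Tr (z\<^sub>1 * U)) + b' * Tr (z\<^sub>2 * U))"
    by (simp add: \<delta>_def mult.assoc distrib_right Tr_prime Tr_simps flip: scale_mult_left)
  have shift: "(+) \<delta> ` y \<in> {y \<in> surviving scale x c. A_digit scale c y = \<alpha>' \<and> B_digit scale U y = \<beta>'}"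
    if "y \<in> surviving scale x c" "A_digit scale c y = \<alpha>" "B_digit scale U y = \<beta>" for y
  proof -
    note y = that
    obtain a where a: "a \<in> y" by (rule survivingE[OF y(1)])
    note sur = survivingD[OF y(1) a]
    have eq: "(+) \<delta> ` y = class_mod_p3 (\<delta> + a)"
    proof
      show "(+) \<delta> ` y \<subseteq> class_mod_p3 (\<delta> + a)"
        by (auto simp: sur(3) class_mod_p3_def)
      show "class_mod_p3 (\<delta> + a) \<subseteq> (+) \<delta> ` y"
      proof
        fix b
        assume "b \<in> class_mod_p3 (\<delta> + a)"
        then have "b - \<delta> \<in> y"
          by (simp add: sur(3) class_mod_p3_def algebra_simps)
        then show "b \<in> (+) \<delta> ` y"
          by (rule rev_image_eqI) simp
      qed
    qed
    obtain q where q: "Tr a - c = of_nat CARD('p) ^ 2 * q" using sur(2) ..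
    obtain r where r: "Tr (a * U) = of_nat CARD('p) ^ 1 * r"
      using prime_dvd_Tr_mult[OF y(1) a] by (auto elim: dvdE)
    have q': "Tr (\<delta> + a) - c =
        of_nat CARD('p) ^ 2 * (q + (a' * Tr z\<^sub>1 + of_nat CARD('p) * (b' * m)))"
      unfolding distrib_left[of _ q] q[symmetric] Tr_\<delta>[symmetric] by (simp add: Tr_simps)
    have r': "Tr ((\<delta> + a) * U) = of_nat CARD('p) ^ 1 *
        (r + (of_nat CARD('p) * (a' * Tr (z\<^sub>1 * U)) + b' * Tr (z\<^sub>2 * U)))"
      unfolding distrib_left[of _ r] r[symmetric] Tr_\<delta>U[symmetric]
      by (simp add: Tr_simps distrib_right)
    have "of_nat CARD('p) dvd (\<delta> + a) - a"
      by (simp add: \<delta>_def)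
    then have "red_mod_p (\<delta> + a) = x"
      unfolding sur(1)[symmetric] by (simp only: red_mod_p_eq_iff)
    then have S: "class_mod_p3 (\<delta> + a) \<in> surviving scale x c"
      by (rule class_survivingI) (simp add: q')
    moreover have mem: "\<delta> + a \<in> class_mod_p3 (\<delta> + a)"
      by (simp add: class_mod_p3_def)
    moreover have "padic_mod_p q = \<alpha>"
      using y(2) unfolding A_digit_eq[OF y(1) a] q padic_quot_mod_p_mult .
    then have "A_digit scale c (class_mod_p3 (\<delta> + a)) = \<alpha>'"
      unfolding A_digit_eq[OF S mem] q' padic_quot_mod_p_mult by (simp add: a' z)
    moreover have "padic_mod_p r = \<beta>"
      using y(3) unfolding B_digit_eq[OF y(1) a] r padic_quot_mod_p_mult .
    then have "B_digit scale U (class_mod_p3 (\<delta> + a)) = \<beta>'"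
      unfolding B_digit_eq[OF S mem] r' padic_quot_mod_p_mult by (simp add: b' z)
    ultimately show ?thesis
      by (simp add: eq)
  qed
  show ?thesis
  proof (rule card_inj_on_le[where f = "(`) ((+) \<delta>)"])
    show "inj_on ((`) ((+) \<delta>)) {y \<in> surviving scale x c. A_digit scale c y = \<alpha> \<and> B_digit scale U y = \<beta>}"
      by (rule inj_on_subset[OF _ subset_UNIV]) (simp add: inj_image_eq_iff inj_on_def)
    show "finite {y \<in> surviving scale x c. A_digit scale c y = \<alpha>' \<and> B_digit scale U y = \<beta>'}"
      using finite_surviving by simp
  qed (use shift in blast)
qed

section \<open>The branch function modulo the cube of p\<close>

lemma branch_fun_cong:
  assumes "y \<in> surviving scale x c" "a \<in> y" "b \<in> y"
  shows "of_nat CARD('p) ^ 3 dvd branch_fun scale U c a T - branch_fun scale U c b T"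
proof -
  have "of_nat CARD('p) ^ 3 dvd a - b"
    using survivingD(3)[OF assms(1,2)] assms(3) by (simp add: class_mod_p3_def)
  then have "of_nat CARD('p) ^ 3 dvd (a - b) * one_plus_p_pow scale U T"
    by (rule dvd_mult2)
  from Tr_dvd[OF this] show ?thesis
    by (simp add: branch_fun_def left_diff_distrib Tr_simps)
qed

text \<open>In the trace of \<open>a\<close> times the truncated series, the linear term has one
  factor p from the series and one from \<open>Tr (a * U)\<close>; the quadratic term has
  \<open>p^2\<close> from the series and contributes \<Delta>. Hence all terms have the common
  factor \<open>p^2\<close>.\<close>

lemma branch_fun_quot:
  assumes y: "y \<in> surviving scale x c" "a \<in> y"
  shows "of_nat CARD('p) ^ 2 dvd branch_fun scale U c a T"
    and "padic_quot_mod_p 2 (branch_fun scale U c a T) =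
      poly (branch_poly scale U c \<Delta> y) (padic_mod_p T)"
proof -
  note sur = survivingD[OF y]
  obtain q where q: "Tr a - c = of_nat CARD('p) ^ 2 * q" using sur(2) ..
  obtain r where r: "Tr (a * U) = of_nat CARD('p) ^ 1 * r"
    using prime_dvd_Tr_mult[OF y] by (auto elim: dvdE)
  let ?b = "padic_binomial T 2"
  let ?s = "1 + scale T (of_nat CARD('p) * U) + scale ?b (of_nat CARD('p) ^ 2 * U ^ 2)"
  have "of_nat CARD('p) ^ 3 dvd a * (?s - one_plus_p_pow scale U T)"
    by (rule dvd_mult) (rule one_plus_p_pow_mod_p3[OF odd_card])
  from Tr_dvd[OF this] have "of_nat CARD('p) ^ 3 dvd Tr (a * ?s) - Tr (a * one_plus_p_pow scale U T)"
    by (simp only: right_diff_distrib Tr_simps)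
  then obtain m where m: "Tr (a * ?s) - Tr (a * one_plus_p_pow scale U T) = of_nat CARD('p) ^ 3 * m" ..
  have "a * ?s = a + scale T (of_nat CARD('p) * (a * U)) + scale ?b (of_nat CARD('p) ^ 2 * (a * U ^ 2))"
    by (simp add: distrib_left mult_scale_right mult.left_commute)
  then have "Tr (a * ?s) = Tr a + T * (of_nat CARD('p) * Tr (a * U)) +
      ?b * (of_nat CARD('p) ^ 2 * Tr (a * U ^ 2))"
    by (simp only: Tr_simps Tr_prime Tr_prime_power)
  then have "branch_fun scale U c a T = (Tr a - c) + T * (of_nat CARD('p) * Tr (a * U)) +
      ?b * (of_nat CARD('p) ^ 2 * Tr (a * U ^ 2)) - of_nat CARD('p) ^ 3 * m"
    unfolding branch_fun_def m[symmetric] by (simp add: algebra_simps)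
  then have eq: "branch_fun scale U c a T =
      of_nat CARD('p) ^ 2 * (q + T * r + ?b * Tr (a * U ^ 2) - of_nat CARD('p) * m)"
    unfolding q r by (simp add: algebra_simps eval_nat_numeral)
  then show "of_nat CARD('p) ^ 2 dvd branch_fun scale U c a T" ..
  have two: "(2 :: 'p mod_ring) \<noteq> 0"
    by (rule two_neq_0_mod_ring[OF odd_card])
  let ?t = "padic_mod_p T"
  \<comment> \<open>The binomial coefficient is known through its double, so the division by 2 is
    carried out in the field.\<close>
  have "padic_mod_p (2 * ?b) = ?t * (?t - 1)"
    unfolding padic_binomial_simps(3)[OF odd_card] by simp
  then have "2 * padic_mod_p ?b = ?t * (?t - 1)"
    using padic_mod_p_of_nat[where ?'p='p, of 2] by simp
  then have b: "padic_mod_p ?b = ?t * (?t - 1) / 2"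
    using two by (simp add: field_simps)
  have A: "padic_mod_p q = A_digit scale c y"
    unfolding A_digit_eq[OF y] q padic_quot_mod_p_mult ..
  have B: "padic_mod_p r = B_digit scale U y"
    unfolding B_digit_eq[OF y] r padic_quot_mod_p_mult ..
  have "padic_quot_mod_p 2 (branch_fun scale U c a T) =
      A_digit scale c y + ?t * B_digit scale U y + ?t * (?t - 1) / 2 * \<Delta>"
    unfolding eq padic_quot_mod_p_mult by (simp add: A B b trace_lift(3)[OF sur(1)])
  also have "\<dots> = poly (branch_poly scale U c \<Delta> y) ?t"
    by (simp add: branch_poly_def algebra_simps)
  finally show "padic_quot_mod_p 2 (branch_fun scale U c a T) =
      poly (branch_poly scale U c \<Delta> y) ?t" .
qed

text \<open>Survival of \<open>T\<close> depends on \<open>T\<close> modulo p only, so the surviving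
  exponents form the full preimage of the root set; reduction is surjective and maps it onto that
  set.\<close>

lemma branch_digits_eq:
  assumes y: "y \<in> surviving scale x c"
  shows "branch_digits scale U c y = {t. poly (branch_poly scale U c \<Delta> y) t = 0}"
proof -
  obtain a0 where a0: "a0 \<in> y" by (rule survivingE[OF y])
  have iff: "of_nat CARD('p) ^ 3 dvd branch_fun scale U c a T \<longleftrightarrow>
      poly (branch_poly scale U c \<Delta> y) (padic_mod_p T) = 0" if "a \<in> y" for a T
    using padic_quot_mod_p_eq_0_iff[OF branch_fun_quot(1)[OF y that]] branch_fun_quot(2)[OF y that]
    by (simp add: eval_nat_numeral)
  then have "{T. \<forall>a\<in>y. of_nat CARD('p) ^ 3 dvd branch_fun scale U c a T} =
      padic_mod_p -` {t. poly (branch_poly scale U c \<Delta> y) t = 0}"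
    using a0 by auto
  moreover have "surj (padic_mod_p :: 'p padic_int \<Rightarrow> 'p mod_ring)"
    by (metis padic_mod_p_surj surjI)
  ultimately show ?thesis
    by (simp only: branch_digits_def surj_image_vimage_eq)
qed

section \<open>Discriminants, fibre sizes and frequencies\<close>

lemma coeff_branch_poly:
  "Polynomial.coeff (branch_poly scale U c \<Delta> y) 0 = A_digit scale c y"
  "Polynomial.coeff (branch_poly scale U c \<Delta> y) 1 = B_digit scale U y - \<Delta> / 2"
  "Polynomial.coeff (branch_poly scale U c \<Delta> y) 2 = \<Delta> / 2"
  by (simp_all add: branch_poly_def numeral_2_eq_2)

lemma degree_branch_poly: "degree (branch_poly scale U c \<Delta> y) = 2"
proof (rule antisym)
  show "degree (branch_poly scale U c \<Delta> y) \<le> 2"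
    unfolding branch_poly_def by (intro degree_add_le) simp_all
  show "2 \<le> degree (branch_poly scale U c \<Delta> y)"
    using two_neq_0_mod_ring[OF odd_card] \<Delta>_nonzero by (intro le_degree) (simp add: coeff_branch_poly)
qed

lemma quadratic_disc_branch_poly:
  "quadratic_disc (branch_poly scale U c \<Delta> y) =
    (B_digit scale U y - \<Delta> / 2)\<^sup>2 - 2 * \<Delta> * A_digit scale c y"
proof -
  have "4 * (\<Delta> / 2) = 2 * (2 * (\<Delta> / 2))" by simp
  also have "\<dots> = 2 * \<Delta>"
    using two_neq_0_mod_ring[OF odd_card] by simp
  finally show ?thesis
    by (simp only: quadratic_disc_def coeff_branch_poly)
qed

lemma branch_digits_cases:
  assumes y: "y \<in> surviving scale x c"
  shows "let Q = branch_poly scale U c \<Delta> y; D = quadratic_disc Q; R = branch_digits scale U c y in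
    (\<not> is_square D \<longrightarrow> R = {}) \<and>
    (D \<noteq> 0 \<and> is_square D \<longrightarrow> card R = 2 \<and> (\<forall>t\<in>R. Polynomial.order t Q = 1)) \<and>
    (D = 0 \<longrightarrow> (\<exists>t. R = {t} \<and> Polynomial.order t Q = 2))"
  using quadratic_discriminant_cases[OF two_neq_0_mod_ring[OF odd_card] degree_branch_poly]
  unfolding Let_def branch_digits_eq[OF y] by blast

text \<open>The fibre size is written through the number of surviving lifts, which does not involve
  \<open>U\<close>. Independence of the choice of \<open>U\<close> is then immediate.\<close>

lemma card_fiber:
  defines "N \<equiv> card (surviving scale x c) div CARD('p) ^ 2"
  shows "N > 0" "card (surviving scale x c) = N * CARD('p) ^ 2"
    and "card {y \<in> surviving scale x c. A_digit scale c y = \<alpha> \<and> B_digit scale U y = \<beta>} = N"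
proof -
  let ?f = "\<lambda>y. (A_digit scale c y, B_digit scale U y)"
  define M where "M = card {y \<in> surviving scale x c. ?f y = (0, 0)}"
  \<comment> \<open>\<open>card_fiber_le\<close> holds for any two fibres, so using it in both
    directions gives equality.\<close>
  have fib: "card {y \<in> surviving scale x c. ?f y = b} = M" for b
    unfolding M_def by (cases b) (auto intro!: antisym card_fiber_le)
  have "card {y \<in> surviving scale x c. True} = M * card {b :: 'p mod_ring \<times> 'p mod_ring. True}"
    by (rule card_Collect_comp_equal_fibers[OF finite_surviving fib])
  then have card: "card (surviving scale x c) = M * CARD('p) ^ 2"
    by (simp add: power2_eq_square)
  have N: "N = M"
    by (simp add: N_def card)
  show "card (surviving scale x c) = N * CARD('p) ^ 2"
    by (simp add: card N)
  show "N > 0"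
  proof -
    have "card (surviving scale x c) > 0"
      using surviving_nonempty finite_surviving by (simp add: card_gt_0_iff)
    then show ?thesis by (simp add: card N)
  qed
  show "card {y \<in> surviving scale x c. A_digit scale c y = \<alpha> \<and> B_digit scale U y = \<beta>} = N"
    using fib[of "(\<alpha>, \<beta>)"] by (simp add: N)
qed

text \<open>For fixed linear digit the discriminant is an affine bijection of the constant digit, so it is
  equidistributed.\<close>

lemma frequency_disc:
  "frequency (surviving scale x c) (\<lambda>y. P (quadratic_disc (branch_poly scale U c \<Delta> y))) =
    real (card {d. P d}) / real CARD('p)"
proof -
  let ?S = "surviving scale x c"
  let ?f = "\<lambda>y. (A_digit scale c y, B_digit scale U y)"
  define disc where "disc = (\<lambda>(\<alpha>, \<beta>). (\<beta> - \<Delta> / 2)\<^sup>2 - 2 * \<Delta> * \<alpha>)"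
  define N where "N = card ?S div CARD('p) ^ 2"
  note N = card_fiber[folded N_def]
  have fib: "card {y \<in> ?S. ?f y = b} = N" for b
    using N(3)[of "fst b" "snd b"] by (simp add: prod_eq_iff)
  have "{y \<in> ?S. P (quadratic_disc (branch_poly scale U c \<Delta> y))} = {y \<in> ?S. P (disc (?f y))}"
    by (simp add: quadratic_disc_branch_poly disc_def)
  also have "card \<dots> = N * card {b. P (disc b)}"
    by (rule card_Collect_comp_equal_fibers[OF finite_surviving fib])
  also have "card {b. P (disc b)} = card ({d. P d} \<times> (UNIV :: 'p mod_ring set))"
  proof (rule bij_betw_same_card)
    have nz: "2 * \<Delta> \<noteq> 0"
      using two_neq_0_mod_ring[OF odd_card] \<Delta>_nonzero by simp
    show "bij_betw (\<lambda>b. (disc b, snd b)) {b. P (disc b)} ({d. P d} \<times> UNIV)"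
      \<comment> \<open>The inverse solves
        \<open>d = (\<beta> - \<Delta>/2)^2 - 2 \<Delta> \<alpha>\<close> for \<alpha>, with \<beta>
        kept.\<close>
      by (rule bij_betw_byWitness[where f' = "\<lambda>(d, \<beta>). (((\<beta> - \<Delta> / 2)\<^sup>2 - d) / (2 * \<Delta>), \<beta>)"])
        (use nz in \<open>auto simp: disc_def\<close>)
  qed
  also have "\<dots> = card {d. P d} * CARD('p)"
    by (simp add: card_cartesian_product)
  finally have "frequency ?S (\<lambda>y. P (quadratic_disc (branch_poly scale U c \<Delta> y))) =
      real (N * (card {d. P d} * CARD('p))) / real (N * CARD('p) ^ 2)"
    by (simp only: frequency_def N(2))
  also have "\<dots> = real (card {d. P d}) / real CARD('p)"
    using N(1) by (simp add: power2_eq_square)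
  finally show ?thesis .
qed

lemma frequency_disc_classes:
  defines "freq \<equiv> \<lambda>P. frequency (surviving scale x c)
    (\<lambda>y. P (quadratic_disc (branch_poly scale U c \<Delta> y)))"
  shows "freq (\<lambda>d. \<not> is_square d) = (real CARD('p) - 1) / (2 * real CARD('p))"
    and "freq (\<lambda>d. d \<noteq> 0 \<and> is_square d) = (real CARD('p) - 1) / (2 * real CARD('p))"
    and "freq (\<lambda>d. d = 0) = 1 / real CARD('p)"
proof -
  let ?sq = "{d :: 'p mod_ring. d \<noteq> 0 \<and> is_square d}" and ?nsq = "{d :: 'p mod_ring. \<not> is_square d}"
  have "2 * card ?sq = CARD('p) - 1"
    using card_nonzero_squares[OF two_neq_0_mod_ring[OF odd_card]] by simp
  then have "2 * card ?sq + 1 = CARD('p)"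
    using zero_less_card_finite[where ?'a='p] by linarith
  then have sq: "2 * real (card ?sq) = real CARD('p) - 1"
    by linarith
  \<comment> \<open>Zero counts as a square, so the three classes are disjoint.\<close>
  have "UNIV = {0} \<union> (?sq \<union> ?nsq)"
    by auto
  then have "CARD('p mod_ring) = card ({0} \<union> (?sq \<union> ?nsq))"
    by simp
  also have "\<dots> = 1 + (card ?sq + card ?nsq)"
    by (subst card_Un_disjoint; (subst card_Un_disjoint)?) auto
  finally have nsq: "2 * real (card ?nsq) = real CARD('p) - 1"
    using sq by simp
  show "freq (\<lambda>d. \<not> is_square d) = (real CARD('p) - 1) / (2 * real CARD('p))"
    unfolding freq_def frequency_disc[of "\<lambda>d. \<not> is_square d"] nsq[symmetric] by simp
  show "freq (\<lambda>d. d \<noteq> 0 \<and> is_square d) = (real CARD('p) - 1) / (2 * real CARD('p))"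
    unfolding freq_def frequency_disc[of "\<lambda>d. d \<noteq> 0 \<and> is_square d"] sq[symmetric] by simp
  show "freq (\<lambda>d. d = 0) = 1 / real CARD('p)"
    unfolding freq_def frequency_disc[of "\<lambda>d. d = 0"] by simp
qed

end

theorem theorem6p5:
  fixes scale :: "'p::prime_card padic_int \<Rightarrow> 'a::comm_ring_1 \<Rightarrow> 'a"
    and \<omega> x :: "('a, 'p) red_alg"
    and s \<Delta> :: "'p mod_ring"
    and U :: 'a
    and c :: "'p padic_int"
  assumes "CARD('p) \<ge> 5"
    and "finite_etale_of_rank 3 scale"
    and "generates_algebra red_scale \<omega>"
    and "x dvd 1"
    and "alg_trace red_scale x = s"
    and "alg_trace red_scale (\<omega> * x) = 0"
    and "\<Delta> = alg_trace red_scale (\<omega> ^ 2 * x)"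
    and "\<Delta> \<noteq> 0"
    and "red_mod_p U = \<omega>"
    and "padic_mod_p c = s"
  shows
    "(\<forall>y \<in> surviving scale x c. \<forall>a\<in>y.
        A_digit scale c y = padic_quot_mod_p 2 (alg_trace scale a - c) \<and>
        of_nat CARD('p) dvd alg_trace scale (a * U) \<and>
        B_digit scale U y = padic_quot_mod_p 1 (alg_trace scale (a * U)))
     \<and>
     (\<exists>N>0. \<forall>\<alpha> \<beta>. card {y \<in> surviving scale x c. A_digit scale c y = \<alpha> \<and> B_digit scale U y = \<beta>} = N)
     \<and>
     (\<forall>y \<in> surviving scale x c.
        (\<forall>a\<in>y. \<forall>b\<in>y. \<forall>T. of_nat CARD('p) ^ 3 dvd branch_fun scale U c a T - branch_fun scale U c b T) \<and>
        (\<forall>a\<in>y. \<forall>T. of_nat CARD('p) ^ 2 dvd branch_fun scale U c a T \<and>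
           padic_quot_mod_p 2 (branch_fun scale U c a T)
             = poly (branch_poly scale U c \<Delta> y) (padic_mod_p T)) \<and>
        {t. poly (branch_poly scale U c \<Delta> y) t = 0} = branch_digits scale U c y)
     \<and>
     (\<forall>y \<in> surviving scale x c.
        let Q = branch_poly scale U c \<Delta> y; D = quadratic_disc Q; R = branch_digits scale U c y in
          (\<not> is_square D \<longrightarrow> R = {}) \<and>
          (D \<noteq> 0 \<and> is_square D \<longrightarrow> card R = 2 \<and> (\<forall>t\<in>R. Polynomial.order t Q = 1)) \<and>
          (D = 0 \<longrightarrow> (\<exists>t. R = {t} \<and> Polynomial.order t Q = 2)))
     \<and>
     (let p = real CARD('p);
          disc = (\<lambda>V y. quadratic_disc (branch_poly scale V c \<Delta> y));
          freq = frequency (surviving scale x c)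
      in
        freq (\<lambda>y. \<not> is_square (disc U y)) = (p - 1) / (2 * p) \<and>
        freq (\<lambda>y. disc U y \<noteq> 0 \<and> is_square (disc U y)) = (p - 1) / (2 * p) \<and>
        freq (\<lambda>y. disc U y = 0) = 1 / p \<and>
        (\<forall>U'. red_mod_p U' = \<omega> \<longrightarrow>
           (\<forall>\<alpha> \<beta>.
              card {y \<in> surviving scale x c. A_digit scale c y = \<alpha> \<and> B_digit scale U' y = \<beta>} =
              card {y \<in> surviving scale x c. A_digit scale c y = \<alpha> \<and> B_digit scale U y = \<beta>}) \<and>
           freq (\<lambda>y. \<not> is_square (disc U' y)) = freq (\<lambda>y. \<not> is_square (disc U y)) \<and>
           freq (\<lambda>y. disc U' y \<noteq> 0 \<and> is_square (disc U' y)) =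
             freq (\<lambda>y. disc U y \<noteq> 0 \<and> is_square (disc U y)) \<and>
           freq (\<lambda>y. disc U' y = 0) = freq (\<lambda>y. disc U y = 0)))"
proof -
  note card = assms(1) and red = assms(5,6) and \<Delta> = assms(7,8) and U = assms(9) and c = assms(10)
  interpret comm_algebra scale
    using assms(2) by (simp add: finite_etale_of_rank_def)
  obtain E where E: "is_finite_basis scale E"
    using assms(2) by (auto simp: finite_etale_of_rank_def)
  have odd: "odd CARD('p)"
    using card prime_odd_nat[OF prime_card[where ?'a='p]] by simp
  \<comment> \<open>Stated for every lift \<open>V\<close> of \<omega>, with the same
    \<open>x\<close>, \<Delta> and \<open>c\<close>, so that all results apply both to
    \<open>U\<close> and to a second lift.\<close>
  have setting: "branch_setting scale E x \<Delta> c V" if "red_mod_p V = \<omega>" for V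
  proof unfold_locales
    show "bij_betw (\<lambda>a b. alg_trace scale (a * b)) UNIV {f. Modules.module_hom scale (*) f}"
      using assms(2) by (simp add: finite_etale_of_rank_def)
  qed (use E odd red \<Delta> c that in simp_all)
  interpret branch_setting scale E x \<Delta> c U
    by (rule setting) fact
  \<comment> \<open>For each lift the frequencies rewrite to expressions in p alone, which settles
    their comparison between two lifts.\<close>
  note [simp] = branch_setting.frequency_disc_classes[OF setting]
  show ?thesis
    unfolding Let_def
  proof (intro conjI ballI allI impI)
    show "\<exists>N>0. \<forall>\<alpha> \<beta>. card {y \<in> surviving scale x c.
        A_digit scale c y = \<alpha> \<and> B_digit scale U y = \<beta>} = N"
      using card_fiber by blast
    show "card {y \<in> surviving scale x c. A_digit scale c y = \<alpha> \<and> B_digit scale U' y = \<beta>} =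
        card {y \<in> surviving scale x c. A_digit scale c y = \<alpha> \<and> B_digit scale U y = \<beta>}"
      if "red_mod_p U' = \<omega>" for U' \<alpha> \<beta>
      by (simp only: card_fiber(3) branch_setting.card_fiber(3)[OF setting[OF that]])
  qed (use U branch_digits_cases in
      \<open>simp_all add: A_digit_eq B_digit_eq prime_dvd_Tr_mult branch_fun_cong branch_fun_quot
        branch_digits_eq Let_def\<close>)
qed

end
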